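(* Let $n\ge1$. Let $A\colon[0,+\infty)\to M(n,\mathbb{R})$ be continuous and bounded, let $f\colon[0,+\infty)\times\mathbb{R}^n\to\mathbb{R}^n$ be continuous with $f(t,0)=0$ for all $t\ge0$, and let $X(t,s)$ denote the transition matrix of $\dot x=A(t)x$. Assume that: (P1) there are a constant $\alpha>0$, a function $D\colon[0,+\infty)\to(0,+\infty)$ and a $C^1$ increasing function $\mu\colon[0,+\infty)\to[1,+\infty)$ with $\mu(0)=1$ and $\lim_{t\to+\infty}\mu(t)=+\infty$ such that $\|X(t,s)\|\le D(s)\left(\frac{\mu(t)}{\mu(s)}\right)^{-\alpha}$ for all $t\ge s\ge 0$; (P2) there are functions $\beta,\gamma\colon[0,+\infty)\to(0,+\infty)$ such that $|f(t,y)|\le\beta(t)$ and $|f(t,y)-f(t,\bar y)|\le\gamma(t)|y-\bar y|$ for all $t\ge0$ and all $y,\bar y\in\mathbb{R}^n$; (P3) $p:=\sup_{t\ge0}\int_0^t D(s)\left(\frac{\mu(t)}{\mu(s)}\right)^{-\alpha}\beta(s)\,ds<+\infty$; (P4) $q:=\sup_{t\ge0}\int_0^t D(s)\left(\frac{\mu(t)}{\mu(s)}\right)^{-\alpha}\gamma(s)\,ds<1$; and that there exist constants $c>0$ and $d\ge1$ such that $\|X(t,s)\|\le c$ whenever $0\le s\le t$ and $\mu(t)\le d\,\mu(s)$. Assume also that $f(t,\cdot)$ is of class $C^2$ for any $t\ge0$. Then there exists a density function $\bar\rho\in C([0,+\infty)\times(\mathbb{R}^n\setminus\{0\}),[0,+\infty))$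 associated to the system $\dot y=A(t)y+f(t,y)$, defined by $$\bar\rho(t,\eta)=\rho(t,G(t,\eta))\,\det\frac{\partial G(t,\eta)}{\partial\eta},$$ where $\rho$ is a (suitable) density function associated to the linear system $\dot x=A(t)x$ and $G(t,\cdot)$ is the orientation-preserving $C^2$ diffeomorphism of $\mathbb{R}^n$ given by $$G(t,\eta)=\eta-\int_0^tX(t,s)f(s,y(s,t,\eta))\,ds .$$
   Context: $X(t,s)=X(t)X^{-1}(s)$, where $X(t)$ is any fundamental matrix of $\dot x=A(t)x$. The functions $D,\beta,\gamma$ are understood to be such that the integrals in (P3) and (P4) are defined. For $\tau\ge 0$ and $\eta\in\mathbb{R}^n$, $t\mapsto y(t,\tau,\eta)$ denotes the solution of $\dot y=A(t)y+f(t,y)$ on $[0,+\infty)$ with $y(\tau,\tau,\eta)=\eta$. A *density function* of a system $\dot z=g(t,z)$ with $g(t,0)=0$ for all $t\ge0$ is a function $\rho\colon[0,+\infty)\times(\mathbb{R}^n\setminus\{0\})\to[0,+\infty)$ of class $C^1$ such that, for any fixed $t\ge0$, $\rho(t,\cdot)$ is integrable outside any ball centered at the origin, and such that for every $t\ge0$ $$\frac{\partial\rho}{\partial t}(t,z)+\nabla\cdot[\rho(t,z)g(t,z)]>0\quad\text{for almost every } z\in\mathbb{R}^n,$$ where $\nabla\cdot[\rho g]=\nabla\rho\cdot g+\rho\,(\nabla\cdot g)$, with gradient and divergence taken with respect to $z$.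
   Formalization: "f(t,·) is of class C² for any t≥0" is strengthened: the y-derivatives of f up to order two are also assumed continuous jointly in (t,y); with mere C² smoothness for each fixed t, G(t,·) can fail to be C². *)

theory Defs
  imports "HOL-Analysis.Analysis"
begin

(* Time ranges over [0, \<infinity>): derivatives in t are taken within {0..}, so they are one-sided
   at t = 0, and values of functions at negative times play no role. *)

definition C1_on :: "'a::real_normed_vector set \<Rightarrow> ('a \<Rightarrow> 'b::real_normed_vector) \<Rightarrow> bool" where
  "C1_on S h \<longleftrightarrow>
     (\<exists>h' :: 'a \<Rightarrow> 'a \<Rightarrow>\<^sub>L 'b.
        (\<forall>x\<in>S. (h has_derivative blinfun_apply (h' x)) (at x within S)) \<and>
        continuous_on S h')"

definition C2 :: "('a::real_normed_vector \<Rightarrow> 'b::real_normed_vector) \<Rightarrow> bool" where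
  "C2 h \<longleftrightarrow>
     (\<exists>(h' :: 'a \<Rightarrow> 'a \<Rightarrow>\<^sub>L 'b) (h'' :: 'a \<Rightarrow> 'a \<Rightarrow>\<^sub>L ('a \<Rightarrow>\<^sub>L 'b)).
        (\<forall>x. (h has_derivative blinfun_apply (h' x)) (at x) \<and>
             (h' has_derivative blinfun_apply (h'' x)) (at x)) \<and>
        continuous_on UNIV h'')"

(* "f(t, -) is of class C^2 for every t \<ge> 0" in the sense usual for right-hand sides of
   differential equations: the derivatives in y up to order two exist and are continuous
   functions of (t, y).  Continuity in y alone, for each fixed t, would not make the solutions
   C^2 functions of their initial values. *)
definition C2_in_state :: "(real \<Rightarrow> 'a::real_normed_vector \<Rightarrow> 'b::real_normed_vector) \<Rightarrow> bool" where
  "C2_in_state f \<longleftrightarrow>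
     (\<exists>(f' :: real \<Rightarrow> 'a \<Rightarrow> 'a \<Rightarrow>\<^sub>L 'b) (f'' :: real \<Rightarrow> 'a \<Rightarrow> 'a \<Rightarrow>\<^sub>L ('a \<Rightarrow>\<^sub>L 'b)).
        (\<forall>t\<ge>0. \<forall>y. (f t has_derivative blinfun_apply (f' t y)) (at y) \<and>
                    (f' t has_derivative blinfun_apply (f'' t y)) (at y)) \<and>
        continuous_on ({0..} \<times> UNIV) (\<lambda>(t, y). f' t y) \<and>
        continuous_on ({0..} \<times> UNIV) (\<lambda>(t, y). f'' t y))"

definition orientation_preserving_C2_diffeo :: "(real^'n \<Rightarrow> real^'n) \<Rightarrow> bool" where
  "orientation_preserving_C2_diffeo F \<longleftrightarrow>
     bij F \<and> C2 F \<and> C2 (inv F) \<and> (\<forall>x. det (jacobian F (at x)) > 0)"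

definition solves_ode :: "(real \<Rightarrow> 'a::real_normed_vector \<Rightarrow> 'a) \<Rightarrow> (real \<Rightarrow> 'a) \<Rightarrow> bool" where
  "solves_ode g \<phi> \<longleftrightarrow>
     (\<forall>t\<ge>0. (\<phi> has_vector_derivative g t (\<phi> t)) (at t within {0..}))"

(* The description is of the value at t, not of the solution as a function, because a solution
   is determined on [0, \<infinity>) only. *)
definition ode_solution :: "(real \<Rightarrow> 'a::real_normed_vector \<Rightarrow> 'a) \<Rightarrow> real \<Rightarrow> real \<Rightarrow> 'a \<Rightarrow> 'a" where
  "ode_solution g t \<tau> \<eta> = (THE v. \<exists>\<phi>. solves_ode g \<phi> \<and> \<phi> \<tau> = \<eta> \<and> \<phi> t = v)"

definition fundamental_matrix :: "(real \<Rightarrow> real^'n^'n) \<Rightarrow> (real \<Rightarrow> real^'n^'n) \<Rightarrow> bool" where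
  "fundamental_matrix A X \<longleftrightarrow> solves_ode (\<lambda>t M. A t ** M) X \<and> (\<forall>t\<ge>0. invertible (X t))"

definition transition :: "(real \<Rightarrow> real^'n^'n) \<Rightarrow> real \<Rightarrow> real \<Rightarrow> real^'n^'n" where
  "transition X t s = X t ** matrix_inv (X s)"

(* The library norm on matrices is not the operator norm induced by the Euclidean norm. *)
definition opnorm :: "real^'n^'n \<Rightarrow> real" where
  "opnorm M = onorm (\<lambda>v. M *v v)"

definition divergence :: "(real^'n \<Rightarrow> real^'n) \<Rightarrow> real^'n \<Rightarrow> real" where
  "divergence h z = trace (jacobian h (at z))"

definition gradient :: "(real^'n \<Rightarrow> real) \<Rightarrow> real^'n \<Rightarrow> real^'n" where
  "gradient h z = (\<chi> i. frechet_derivative h (at z) (axis i 1))"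

(* A density is a function of z \<noteq> 0; its values at z = 0 are irrelevant here. *)
definition density_function ::
    "(real \<Rightarrow> real^'n \<Rightarrow> real^'n) \<Rightarrow> (real \<Rightarrow> real^'n \<Rightarrow> real) \<Rightarrow> bool" where
  "density_function g \<rho> \<longleftrightarrow>
     (\<forall>t\<ge>0. g t 0 = 0) \<and>
     (\<forall>t\<ge>0. \<forall>z. z \<noteq> 0 \<longrightarrow> \<rho> t z \<ge> 0) \<and>
     C1_on ({0..} \<times> (- {0})) (\<lambda>(t, z). \<rho> t z) \<and>
     (\<forall>t\<ge>0. \<forall>r>0. set_integrable lborel (- ball 0 r) (\<rho> t)) \<and>
     (\<forall>t\<ge>0. AE z in lborel.
        vector_derivative (\<lambda>s. \<rho> s z) (at t within {0..})
        + (gradient (\<rho> t) z \<bullet> g t z + \<rho> t z * divergence (g t) z) > 0)"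

end

theory Submission
  imports Defs "HOL-Probability.Distributions"
begin

text \<open>Let \<open>\<Phi> t\<close> be the time-\<open>t\<close> map of the perturbed system started at time \<open>0\<close>; it exists on all of
  \<open>[0, \<infinity>)\<close> because (P4) makes the Duhamel operator a contraction. By variation of constants
  \<open>G t = X(t, 0) \<circ> (\<Phi> t)\<^sup>-\<^sup>1\<close>, and (P3) makes \<open>\<Phi> t\<close> proper, hence bijective; so \<open>G t\<close> is a
  \<open>C\<^sup>2\<close> diffeomorphism by smooth dependence on initial values and Liouville's formula.

  For any such flow the density \<open>(1 + t) exp (- \<bar>\<xi>\<bar>\<^sup>2)\<close> of the initial value \<open>\<xi>\<close>, pushed forward by
  \<open>\<Phi> t\<close>, is a density function: along trajectories the continuity expression times \<open>det D\<Phi>\<close> is the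
  time derivative \<open>exp (- \<bar>\<xi>\<bar>\<^sup>2)\<close>. Applied to the linear and to the perturbed system this gives \<open>\<rho>\<close> and
  \<open>\<rho>bar\<close>, and both are images of the same function of \<open>\<xi>\<close>, so \<open>G t\<close> carries one to the other.\<close>

text \<open>Integrability is obtained by domination, without a change of variables. At fixed t the
  flow grows at most linearly in the initial value, so the transported Gaussian stays below a wider
  Gaussian provided that 1 / det DPhi is bounded in the state. Liouville's formula reduces this to a
  lower bound for the integrated divergence. Here lies an obstacle: gamma, which bounds the
  derivative of f, is not itself assumed integrable; only its product with the kernel in (P4) is.
  But that kernel dominates the norm of the invertible matrix X(t, s), hence is bounded away from 0
  for s in [0, t], and so gamma lies below an integrable function.

  A second obstacle is the edge t = 0 of the time domain: the half-space of pairs (t, eta) is not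
  open, so the inverse function theorem does not apply there directly. Continuity of the inverse
  flow comes instead from properness uniform on compact time intervals, and its differentiability
  then follows from continuity and the invertible one-sided derivative.\<close>

section \<open>Continuously differentiable maps\<close>

text \<open>On a finite-dimensional domain, continuity of a derivative in operator norm follows from
  continuity of its value at every fixed vector. Derivatives can therefore be given as plain
  functions.\<close>

lemma C1_onI:
  fixes h :: "'a::euclidean_space \<Rightarrow> 'b::real_normed_vector"
  assumes h: "\<And>x. x \<in> S \<Longrightarrow> (h has_derivative h' x) (at x within S)"
    and cont: "\<And>v. continuous_on S (\<lambda>x. h' x v)"
  shows "C1_on S h"
  unfolding C1_on_def
proof (intro exI conjI ballI)
  have *: "blinfun_apply (Blinfun (h' x)) = h' x" if "x \<in> S" for x
    using has_derivative_bounded_linear[OF h[OF that]] by (rule bounded_linear_Blinfun_apply)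
  show "(h has_derivative blinfun_apply (Blinfun (h' x))) (at x within S)" if "x \<in> S" for x
    using h[OF that] *[OF that] by simp
  show "continuous_on S (\<lambda>x. Blinfun (h' x))"
  proof (rule continuous_on_blinfun_componentwise)
    show "continuous_on S (\<lambda>x. blinfun_apply (Blinfun (h' x)) i)" for i
      using cont[of i] by (rule continuous_on_eq) (simp add: *)
  qed
qed

lemma C1_on_imp_continuous_on: "C1_on S h \<Longrightarrow> continuous_on S h"
  unfolding C1_on_def by (meson has_derivative_continuous continuous_on_eq_continuous_within)

lemma C1_on_subset: "C1_on S h \<Longrightarrow> T \<subseteq> S \<Longrightarrow> C1_on T h"
  unfolding C1_on_def by (meson has_derivative_subset continuous_on_subset subsetD)

lemma C1_on_cong:
  assumes "C1_on S h" "\<And>x. x \<in> S \<Longrightarrow> h x = k x"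
  shows "C1_on S k"
  using assms unfolding C1_on_def by (metis has_derivative_transform)

lemma C1_on_compose:
  assumes f: "C1_on S f" and g: "C1_on T g" and ST: "f ` S \<subseteq> T"
  shows "C1_on S (\<lambda>x. g (f x))"
proof -
  obtain f' where f': "\<And>x. x \<in> S \<Longrightarrow> (f has_derivative blinfun_apply (f' x)) (at x within S)"
      "continuous_on S f'" using f unfolding C1_on_def by blast
  obtain g' where g': "\<And>x. x \<in> T \<Longrightarrow> (g has_derivative blinfun_apply (g' x)) (at x within T)"
      "continuous_on T g'" using g unfolding C1_on_def by blast
  show ?thesis unfolding C1_on_def
  proof (intro exI conjI ballI)
    show "((\<lambda>x. g (f x)) has_derivative blinfun_apply (g' (f x) o\<^sub>L f' x)) (at x within S)"
      if "x \<in> S" for x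
      using diff_chain_within[OF f'(1)[OF that] has_derivative_subset[OF g'(1) ST]] ST that
      by (auto simp: o_def image_subset_iff blinfun_compose.rep_eq)
    show "continuous_on S (\<lambda>x. g' (f x) o\<^sub>L f' x)"
      using ST by (intro bounded_bilinear.continuous_on[OF bounded_bilinear_blinfun_compose] f'
          continuous_on_compose2[OF g'(2) C1_on_imp_continuous_on[OF f]])
  qed
qed

lemma C1_on_bounded_linear: "bounded_linear h \<Longrightarrow> C1_on S h"
  unfolding C1_on_def
  by (intro exI[of _ "\<lambda>_. Blinfun h"] conjI ballI)
    (simp_all add: bounded_linear_Blinfun_apply bounded_linear_imp_has_derivative)

lemma C1_on_linear_compose: "bounded_linear h \<Longrightarrow> C1_on S f \<Longrightarrow> C1_on S (\<lambda>x. h (f x))"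
  using C1_on_compose[OF _ C1_on_bounded_linear[of h UNIV]] by auto

lemma C1_on_const: "C1_on S (\<lambda>_. c)"
  unfolding C1_on_def by (intro exI[of _ "\<lambda>_. 0"] conjI ballI) (simp_all add: zero_blinfun.rep_eq)

lemma C1_on_Pair:
  fixes f :: "'a::euclidean_space \<Rightarrow> 'b::real_normed_vector"
    and g :: "'a \<Rightarrow> 'c::real_normed_vector"
  assumes f: "C1_on S f" and g: "C1_on S g"
  shows "C1_on S (\<lambda>x. (f x, g x))"
proof -
  obtain f' where f': "\<And>x. x \<in> S \<Longrightarrow> (f has_derivative blinfun_apply (f' x)) (at x within S)"
      "continuous_on S f'" using f unfolding C1_on_def by blast
  obtain g' where g': "\<And>x. x \<in> S \<Longrightarrow> (g has_derivative blinfun_apply (g' x)) (at x within S)"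
      "continuous_on S g'" using g unfolding C1_on_def by blast
  show ?thesis
    by (rule C1_onI[where h'="\<lambda>x v. (f' x v, g' x v)"])
      (auto intro!: has_derivative_Pair f' g' continuous_intros)
qed

lemma C1_on_mult:
  fixes f g :: "'a::euclidean_space \<Rightarrow> real"
  assumes f: "C1_on S f" and g: "C1_on S g"
  shows "C1_on S (\<lambda>x. f x * g x)"
proof -
  obtain f' where f': "\<And>x. x \<in> S \<Longrightarrow> (f has_derivative blinfun_apply (f' x)) (at x within S)"
      "continuous_on S f'" using f unfolding C1_on_def by blast
  obtain g' where g': "\<And>x. x \<in> S \<Longrightarrow> (g has_derivative blinfun_apply (g' x)) (at x within S)"
      "continuous_on S g'" using g unfolding C1_on_def by blast
  show ?thesis
  proof (rule C1_onI[where h'="\<lambda>x v. f x * g' x v + f' x v * g x"])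
    show "((\<lambda>x. f x * g x) has_derivative (\<lambda>v. f x * g' x v + f' x v * g x)) (at x within S)"
      if "x \<in> S" for x
      using has_derivative_mult[OF f'(1)[OF that] g'(1)[OF that]] .
    show "continuous_on S (\<lambda>x. f x * g' x v + f' x v * g x)" for v
      by (intro continuous_intros f'(2) g'(2) C1_on_imp_continuous_on f g)
  qed
qed

lemma C1_on_add:
  fixes f g :: "'a::euclidean_space \<Rightarrow> 'b::real_normed_vector"
  assumes f: "C1_on S f" and g: "C1_on S g"
  shows "C1_on S (\<lambda>x. f x + g x)"
  using C1_on_linear_compose[OF bounded_linear_add[OF bounded_linear_fst bounded_linear_snd]
      C1_on_Pair[OF f g]] by simp

lemma C1_on_sum:
  fixes f :: "'i \<Rightarrow> 'a::euclidean_space \<Rightarrow> 'b::real_normed_vector"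
  assumes "\<And>i. i \<in> I \<Longrightarrow> C1_on S (f i)"
  shows "C1_on S (\<lambda>x. \<Sum>i\<in>I. f i x)"
  using assms by (induction I rule: infinite_finite_induct) (auto intro!: C1_on_add C1_on_const)

lemma C1_on_prod:
  fixes f :: "'i \<Rightarrow> 'a::euclidean_space \<Rightarrow> real"
  assumes "\<And>i. i \<in> I \<Longrightarrow> C1_on S (f i)"
  shows "C1_on S (\<lambda>x. \<Prod>i\<in>I. f i x)"
  using assms by (induction I rule: infinite_finite_induct) (auto intro!: C1_on_mult C1_on_const)

lemma C1_on_real:
  fixes f f' :: "real \<Rightarrow> real"
  assumes "\<And>x. x \<in> S \<Longrightarrow> (f has_field_derivative f' x) (at x within S)" "continuous_on S f'"
  shows "C1_on S f"
  by (rule C1_onI[where h'="\<lambda>x v. f' x * v"])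
    (auto intro!: continuous_intros assms simp: has_field_derivative_def[symmetric])

lemma C1_on_inverse:
  fixes f :: "'a::euclidean_space \<Rightarrow> real"
  assumes "C1_on S f" "\<And>x. x \<in> S \<Longrightarrow> f x \<noteq> 0"
  shows "C1_on S (\<lambda>x. inverse (f x))"
proof (rule C1_on_compose[OF assms(1)])
  show "C1_on (- {0}) (inverse :: real \<Rightarrow> real)"
    by (rule C1_on_real[where f'="\<lambda>x. - (inverse x * inverse x)"])
      (auto intro!: derivative_eq_intros continuous_intros)
qed (use assms in auto)

lemma C1_on_exp:
  fixes f :: "'a::euclidean_space \<Rightarrow> real"
  assumes "C1_on S f"
  shows "C1_on S (\<lambda>x. exp (f x))"
proof (rule C1_on_compose[OF assms])
  show "C1_on UNIV (exp :: real \<Rightarrow> real)"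
    by (rule C1_on_real[where f'=exp]) (auto intro!: derivative_eq_intros continuous_intros)
qed simp

lemma C1_on_inner_self:
  fixes f :: "'a::euclidean_space \<Rightarrow> 'b::real_inner"
  assumes "C1_on S f"
  shows "C1_on S (\<lambda>x. f x \<bullet> f x)"
proof -
  obtain f' where f': "\<And>x. x \<in> S \<Longrightarrow> (f has_derivative blinfun_apply (f' x)) (at x within S)"
      "continuous_on S f'" using assms unfolding C1_on_def by blast
  show ?thesis
  proof (rule C1_onI[where h'="\<lambda>x v. f x \<bullet> f' x v + f' x v \<bullet> f x"])
    show "((\<lambda>x. f x \<bullet> f x) has_derivative (\<lambda>v. f x \<bullet> f' x v + f' x v \<bullet> f x)) (at x within S)"
      if "x \<in> S" for x
      using has_derivative_inner[OF f'(1)[OF that] f'(1)[OF that]] .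
    show "continuous_on S (\<lambda>x. f x \<bullet> f' x v + f' x v \<bullet> f x)" for v
      by (intro continuous_intros f'(2) C1_on_imp_continuous_on assms)
  qed
qed

lemma C1_on_vec:
  fixes f :: "'a::euclidean_space \<Rightarrow> 'b::euclidean_space^'n"
  assumes f: "\<And>i. C1_on S (\<lambda>x. f x $ i)"
  shows "C1_on S f"
proof (rule C1_on_cong)
  have "bounded_linear (\<lambda>y. axis i y :: 'b^'n)" for i
    by (intro linear_conv_bounded_linear[THEN iffD1] linearI) (simp_all add: axis_def vec_eq_iff)
  from C1_on_linear_compose[OF this f]
  show "C1_on S (\<lambda>x. \<Sum>i\<in>UNIV. axis i (f x $ i) :: 'b^'n)"
    by (rule C1_on_sum)
  show "(\<Sum>i\<in>UNIV. axis i (f x $ i)) = f x" for x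
    by (simp add: vec_eq_iff axis_def)
qed

lemma C1_on_component:
  fixes f :: "'a::euclidean_space \<Rightarrow> 'b::real_normed_vector^'n"
  shows "C1_on S f \<Longrightarrow> C1_on S (\<lambda>x. f x $ i)"
  by (rule C1_on_linear_compose[OF bounded_linear_vec_nth])

lemma C1_on_det:
  fixes f :: "'a::euclidean_space \<Rightarrow> real^'n^'n"
  assumes "C1_on S f"
  shows "C1_on S (\<lambda>x. det (f x))"
  unfolding det_def
  by (intro C1_on_sum C1_on_mult C1_on_const C1_on_prod C1_on_component assms)

section \<open>Inversion of matrix-valued functions\<close>

lemma matrix_inv_works:
  fixes M :: "real^'n^'n"
  assumes "invertible M"
  shows matrix_inv_right: "M ** matrix_inv M = mat 1" and matrix_inv_left: "matrix_inv M ** M = mat 1"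
  using assms someI_ex[of "\<lambda>A'. M ** A' = mat 1 \<and> A' ** M = mat 1"]
  unfolding invertible_def matrix_inv_def by auto

text \<open>Cramer's rule writes every entry of the inverse as a quotient of determinants, and these
  are polynomials in the entries.\<close>

lemma C1_on_matrix_inv:
  fixes f :: "'a::euclidean_space \<Rightarrow> real^'n^'n"
  assumes f: "C1_on S f" and inv: "\<And>x. x \<in> S \<Longrightarrow> invertible (f x)"
  shows "C1_on S (\<lambda>x. matrix_inv (f x))"
proof (rule C1_on_vec, rule C1_on_vec)
  fix k l
  \<comment> \<open>Cramer's rule is applied to the linear system whose solution is column
    \<open>l\<close> of the inverse; its component \<open>k\<close> requires overwriting column
    \<open>k\<close> by the right-hand side.\<close>
  define g where "g x = (\<chi> i j. if j = k then axis l 1 $ i else f x $ i $ j)" for x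
  have det: "det (f x) \<noteq> 0" if "x \<in> S" for x
    using inv[OF that] invertible_det_nz by blast
  have "C1_on S (\<lambda>x. det (g x) * inverse (det (f x)))"
  proof (intro C1_on_mult C1_on_inverse C1_on_det f det)
    show "C1_on S g"
    proof (rule C1_on_vec, rule C1_on_vec)
      show "C1_on S (\<lambda>x. g x $ i $ j)" for i j
        by (cases "j = k") (auto simp: g_def intro!: C1_on_const C1_on_component f)
    qed
  qed
  then show "C1_on S (\<lambda>x. matrix_inv (f x) $ k $ l)"
  proof (rule C1_on_cong)
    fix x assume x: "x \<in> S"
    have "f x *v (matrix_inv (f x) *v axis l 1) = axis l 1"
      using matrix_inv_right[OF inv[OF x]] by (simp add: matrix_vector_mul_assoc)
    then have "matrix_inv (f x) *v axis l 1
        = (\<chi> k. det (\<chi> i j. if j = k then axis l 1 $ i else f x $ i $ j) / det (f x))"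
      using cramer[OF det[OF x]] by blast
    then have "(matrix_inv (f x) *v axis l 1) $ k = det (g x) / det (f x)"
      by (simp add: g_def)
    moreover have "(matrix_inv (f x) *v axis l 1) $ k = matrix_inv (f x) $ k $ l"
      by (simp add: matrix_vector_mul_component inner_axis)
    ultimately show "det (g x) * inverse (det (f x)) = matrix_inv (f x) $ k $ l"
      by (simp add: field_simps)
  qed
qed

lemma bounded_linear_Blinfun_matrix:
  "bounded_linear (\<lambda>M::real^'n^'m. Blinfun ((*v) M))"
proof (rule linear_conv_bounded_linear[THEN iffD1], rule linearI)
  have [simp]: "blinfun_apply (Blinfun ((*v) M)) = (*v) M" for M :: "real^'n^'m"
    by (rule bounded_linear_Blinfun_apply) simp
  show "Blinfun ((*v) (M + N)) = Blinfun ((*v) M) + Blinfun ((*v) N)" for M N :: "real^'n^'m"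
    by (rule blinfun_eqI) (simp add: blinfun.add_left matrix_vector_mult_add_rdistrib)
  show "Blinfun ((*v) (r *\<^sub>R M)) = r *\<^sub>R Blinfun ((*v) M)" for r and M :: "real^'n^'m"
    by (rule blinfun_eqI) (simp add: blinfun.scaleR_left scaleR_matrix_vector_assoc)
qed

text \<open>Reduces second-order smoothness to the first-order calculus above: it suffices that the
  Jacobian matrix is a \<open>C1_on\<close> function.\<close>

lemma C2I:
  fixes h :: "real^'n \<Rightarrow> real^'m"
  assumes h: "\<And>x. (h has_derivative (*v) (H x)) (at x)" and H: "C1_on UNIV H"
  shows "C2 h"
proof -
  have [simp]: "blinfun_apply (Blinfun ((*v) M)) = (*v) M" for M :: "real^'n^'m"
    by (rule bounded_linear_Blinfun_apply) simp
  have "C1_on UNIV (\<lambda>x. Blinfun ((*v) (H x)))"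
    by (rule C1_on_linear_compose[OF bounded_linear_Blinfun_matrix H])
  then obtain h'' where "\<forall>x. ((\<lambda>x. Blinfun ((*v) (H x))) has_derivative blinfun_apply (h'' x)) (at x)"
      "continuous_on UNIV h''"
    unfolding C1_on_def by auto
  then show ?thesis
    unfolding C2_def using h by (intro exI[of _ "\<lambda>x. Blinfun ((*v) (H x))"] exI[of _ h'']) simp
qed

section \<open>Determinants and Gaussians\<close>

text \<open>Differentiating the determinant row by row, only the multiple of the row itself survives
  in each row of \<open>B ** M t\<close>.\<close>

lemma has_real_derivative_det:
  fixes M :: "real \<Rightarrow> real^'n^'n"
  assumes M: "(M has_vector_derivative B ** M t) (at t within S)"
  shows "((\<lambda>t. det (M t)) has_real_derivative trace B * det (M t)) (at t within S)"
proof -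
  have comp: "((\<lambda>t. M t $ i $ j) has_derivative (\<lambda>h. h * (B ** M t) $ i $ j)) (at t within S)" for i j
    using bounded_linear.has_derivative[OF bounded_linear_vec_nth,
        OF bounded_linear.has_derivative[OF bounded_linear_vec_nth, OF M[unfolded has_vector_derivative_def]]]
    by simp
  let ?R = "\<lambda>i. (\<chi> k. if k = i then (B ** M t) $ i else M t $ k) :: real^'n^'n"
  have row: "det (?R i) = B $ i $ i * det (M t)" for i
  proof -
    have "?R i = (\<chi> k. if k = i then \<Sum>l\<in>UNIV. B $ i $ l *s M t $ l else M t $ k)"
      by (simp add: vec_eq_iff matrix_matrix_mult_def)
    then have "det (?R i) = (\<Sum>l\<in>UNIV. B $ i $ l * det (\<chi> k. if k = i then M t $ l else M t $ k))"
      by (simp add: det_linear_row_sum det_row_mul)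
    also have "\<dots> = (\<Sum>l\<in>UNIV. if l = i then B $ i $ i * det (M t) else 0)"
    proof (rule sum.cong)
      fix l
      show "B $ i $ l * det (\<chi> k. if k = i then M t $ l else M t $ k) = (if l = i then B $ i $ i * det (M t) else 0)"
      proof (cases "l = i")
        case True
        moreover have "(\<chi> k. if k = i then M t $ i else M t $ k) = M t" by (simp add: vec_eq_iff)
        ultimately show ?thesis using True by (simp only: if_True)
      next
        case False
        then have "det (\<chi> k. if k = i then M t $ l else M t $ k) = 0"
          by (intro det_identical_rows[of l i]) (auto simp: row_def)
        then show ?thesis using False by simp
      qed
    qed simp
    finally show ?thesis by simp
  qed
  have "((\<lambda>t. det (M t)) has_derivative (\<lambda>h. \<Sum>p | p permutes UNIV. of_int (sign p) *
      (\<Sum>i\<in>UNIV. h * (B ** M t) $ i $ p i * (\<Prod>j\<in>UNIV - {i}. M t $ j $ p j)))) (at t within S)"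
    unfolding det_def by (intro has_derivative_sum has_derivative_mult_right has_derivative_prod comp)
  also have "(\<lambda>h. \<Sum>p | p permutes UNIV. of_int (sign p) *
      (\<Sum>i\<in>UNIV. h * (B ** M t) $ i $ p i * (\<Prod>j\<in>UNIV - {i}. M t $ j $ p j))) = (*) (trace B * det (M t))"
  proof
    fix h :: real
    have "(\<Sum>p | p permutes UNIV. of_int (sign p) *
      (\<Sum>i\<in>UNIV. h * (B ** M t) $ i $ p i * (\<Prod>j\<in>UNIV - {i}. M t $ j $ p j)))
      = (\<Sum>p | p permutes UNIV. \<Sum>i\<in>UNIV. h * (of_int (sign p) * (\<Prod>j\<in>UNIV. ?R i $ j $ p j)))"
    proof (intro sum.cong refl)
      fix p
      have "h * (of_int (sign p) * (\<Prod>j\<in>UNIV. ?R i $ j $ p j))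
        = of_int (sign p) * (h * (B ** M t) $ i $ p i * (\<Prod>j\<in>UNIV - {i}. M t $ j $ p j))" for i
      proof -
        have "(\<Prod>j\<in>UNIV. ?R i $ j $ p j) = ?R i $ i $ p i * (\<Prod>j\<in>UNIV - {i}. ?R i $ j $ p j)"
          by (rule prod.remove) auto
        also have "\<dots> = (B ** M t) $ i $ p i * (\<Prod>j\<in>UNIV - {i}. M t $ j $ p j)"
          by (auto intro!: prod.cong)
        finally show ?thesis by simp
      qed
      then show "of_int (sign p) * (\<Sum>i\<in>UNIV. h * (B ** M t) $ i $ p i * (\<Prod>j\<in>UNIV - {i}. M t $ j $ p j))
        = (\<Sum>i\<in>UNIV. h * (of_int (sign p) * (\<Prod>j\<in>UNIV. ?R i $ j $ p j)))"
        by (simp only: sum_distrib_left)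
    qed
    \<comment> \<open>With the sums interchanged, the sum over permutations for a fixed row
      \<open>i\<close> is the Leibniz formula for \<open>?R i\<close>.\<close>
    also have "\<dots> = (\<Sum>i\<in>UNIV. h * det (?R i))"
      unfolding det_def by (subst sum.swap) (simp add: sum_distrib_left)
    also have "\<dots> = trace B * det (M t) * h"
      by (simp add: row trace_def sum_distrib_left sum_distrib_right mult_ac)
    finally show "(\<Sum>p | p permutes UNIV. of_int (sign p) *
      (\<Sum>i\<in>UNIV. h * (B ** M t) $ i $ p i * (\<Prod>j\<in>UNIV - {i}. M t $ j $ p j))) = trace B * det (M t) * h" .
  qed
  finally show ?thesis by (simp add: has_field_derivative_def)
qed

text \<open>The exponential of a sum of squares is a product over \<open>Basis\<close>, so Tonelli
  reduces the claim to one dimension, where the function is a multiple of a normal density.\<close>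

lemma integrable_gaussian:
  fixes a :: real
  assumes a: "a > 0"
  shows "integrable lborel (\<lambda>x::'a::euclidean_space. exp (- a * (x \<bullet> x)))"
proof (rule integrableI_nonneg)
  have 1: "(\<integral>\<^sup>+x. ennreal (exp (- a * x\<^sup>2)) \<partial>lborel) < \<infinity>" (is "?I < _")
  proof -
    \<comment> \<open>The standard deviation for which the exponent
      \<open>x\<^sup>2 / (2 * \<sigma>\<^sup>2)\<close> of the normal density equals
      \<open>a * x\<^sup>2\<close>.\<close>
    define \<sigma> where "\<sigma> = 1 / sqrt (2 * a)"
    have \<sigma>: "\<sigma> > 0" "2 * \<sigma>\<^sup>2 = 1 / a" using a by (auto simp: \<sigma>_def power_divide)
    have "integrable lborel (\<lambda>x. sqrt (2 * pi * \<sigma>\<^sup>2) * normal_density 0 \<sigma> x)"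
      using \<sigma> by (intro integrable_mult_right) (simp add: integrable_normal_density)
    then have "integrable lborel (\<lambda>x. exp (- a * x\<^sup>2))"
      using \<sigma> a by (simp add: normal_density_def mult.commute)
    then show ?thesis
      by (simp add: integrable_iff_bounded)
  qed
  have gauss: "ennreal (exp (- a * (x \<bullet> x))) = (\<Prod>b\<in>Basis. ennreal (exp (- a * (x \<bullet> b)\<^sup>2)))" for x :: 'a
  proof -
    have "- a * (x \<bullet> x) = (\<Sum>b\<in>Basis. - a * (x \<bullet> b)\<^sup>2)"
      by (subst euclidean_inner) (simp only: sum_distrib_left power2_eq_square)
    then show ?thesis by (simp only: exp_sum finite_Basis) (simp add: prod_ennreal)
  qed
  have "(\<integral>\<^sup>+x. ennreal (exp (- a * (x \<bullet> x))) \<partial>(lborel::'a measure))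
      = (\<integral>\<^sup>+x. (\<Prod>b\<in>Basis. ennreal (exp (- a * (x \<bullet> b)\<^sup>2))) \<partial>(lborel::'a measure))"
    by (simp only: gauss)
  also have "\<dots> = (\<Prod>b\<in>(Basis::'a set). ?I)"
    by (rule nn_integral_lborel_prod) auto
  also have "\<dots> < \<infinity>"
    using 1 by (simp add: power_less_top_ennreal)
  finally show "(\<integral>\<^sup>+x. ennreal (exp (- a * (x \<bullet> x))) \<partial>(lborel::'a measure)) < \<infinity>" .
qed auto

section \<open>Ordinary differential equations\<close>

lemma has_vector_derivative_integral_atLeast:
  fixes g :: "real \<Rightarrow> 'a::banach"
  assumes g: "continuous_on {0..} g" and t: "t \<ge> 0"
  shows "((\<lambda>t. integral {0..t} g) has_vector_derivative g t) (at t within {0..})"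
proof -
  have "((\<lambda>t. integral {0..t} g) has_vector_derivative g t) (at t within {0..t + 1})"
    using t by (intro integral_has_vector_derivative continuous_on_subset[OF g]) auto
  \<comment> \<open>The interval ends at \<open>t + 1\<close> so that \<open>t\<close> lies below
    its right end and both filters agree.\<close>
  moreover have "at t within {0..t + 1} = at t within {0..}"
    by (rule at_within_nhd[where S="{..<t + 1}"]) auto
  ultimately show ?thesis by simp
qed

lemma has_vector_derivative_imp_continuous_on:
  "(\<And>t. t \<in> S \<Longrightarrow> (\<phi> has_vector_derivative \<phi>' t) (at t within S)) \<Longrightarrow> continuous_on S \<phi>"
  unfolding continuous_on_eq_continuous_within by (blast intro: has_vector_derivative_continuous)

lemma solves_ode_continuous_on: "solves_ode g \<phi> \<Longrightarrow> continuous_on {0..} \<phi>"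
  unfolding solves_ode_def by (rule has_vector_derivative_imp_continuous_on) auto

lemma solves_ode_within:
  "solves_ode g \<phi> \<Longrightarrow> t \<in> {0..T} \<Longrightarrow> (\<phi> has_vector_derivative g t (\<phi> t)) (at t within {0..T})"
  unfolding solves_ode_def by (auto intro: has_vector_derivative_within_subset)

text \<open>The norm of \<open>u\<close> may fail to be differentiable where \<open>u\<close>
  vanishes. The argument therefore runs on the integral majorant \<open>v\<close>, which satisfies
  \<open>v' \<le> L * v + \<delta>\<close>.\<close>

lemma gronwall:
  fixes u :: "real \<Rightarrow> 'a::banach"
  assumes u: "\<And>t. t \<in> {0..T} \<Longrightarrow> (u has_vector_derivative u' t) (at t within {0..T})"
    and bound: "\<And>t. t \<in> {0..T} \<Longrightarrow> norm (u' t) \<le> L * norm (u t) + \<delta>"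
    and L: "L \<ge> 0" and \<delta>: "\<delta> \<ge> 0" and t: "t \<in> {0..T}"
  shows "norm (u t) \<le> (norm (u 0) + \<delta> * t) * exp (L * t)"
proof -
  have cont: "continuous_on {0..T} u"
    using u by (rule has_vector_derivative_imp_continuous_on)
  define g where "g r = L * norm (u r) + \<delta>" for r
  have contg: "continuous_on {0..T} g" unfolding g_def by (intro continuous_intros cont)
  define v where "v s = norm (u 0) + integral {0..s} g" for s
  have le: "norm (u s) \<le> v s" if s: "s \<in> {0..T}" for s
  proof -
    have hi: "(u' has_integral (u s - u 0)) {0..s}"
      using s by (intro fundamental_theorem_of_calculus has_vector_derivative_within_subset[OF u]) auto
    have "norm (integral {0..s} u') \<le> integral {0..s} g"
    proof (rule integral_norm_bound_integral)
      show "u' integrable_on {0..s}" using hi by blast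
      show "g integrable_on {0..s}"
        using s by (intro integrable_continuous_real continuous_on_subset[OF contg]) auto
      show "norm (u' r) \<le> g r" if "r \<in> {0..s}" for r
        using bound[of r] that s by (auto simp: g_def)
    qed
    with hi have "norm (u s - u 0) \<le> integral {0..s} g" by (simp add: integral_unique)
    then show ?thesis unfolding v_def using norm_triangle_sub[of "u s" "u 0"] by linarith
  qed
  have dv: "(v has_real_derivative g s) (at s within {0..T})" if "s \<in> {0..T}" for s
    unfolding v_def
    by (auto intro!: derivative_eq_intros integral_has_real_derivative[OF contg that])
  \<comment> \<open>Since \<open>exp (- L * s) \<le> 1\<close>, subtracting
    \<open>\<delta> * s\<close> is enough to absorb the forcing term and make \<open>w\<close>
    nonincreasing; this is where the factor \<open>\<delta> * t\<close> of the bound arises.\<close>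
  define w where "w s = v s * exp (- L * s) - \<delta> * s" for s
  have dw: "(w has_real_derivative (g s * exp (- L * s) - L * v s * exp (- L * s) - \<delta>)) (at s within {0..T})"
    if "s \<in> {0..T}" for s
    unfolding w_def by (auto intro!: derivative_eq_intros dv[OF that] simp: algebra_simps)
  have "w t \<le> w 0"
  proof (rule DERIV_nonpos_imp_decreasing_open[where f = w and a = 0 and b = t])
    show "0 \<le> t" using t by simp
    show "continuous_on {0..t} w"
      using t by (intro continuous_on_subset[OF DERIV_continuous_on[OF dw]]) auto
    fix s assume s: "0 < s" "s < t"
    then have s': "s \<in> {0..T}" using t by auto
    have "at s within {0..T} = at s"
      using s t by (intro at_within_interior) auto
    with dw[OF s'] have 1: "(w has_real_derivative (g s * exp (- L * s) - L * v s * exp (- L * s) - \<delta>)) (at s)"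
      by simp
    have "exp (- L * s) \<le> 1" using L s by simp
    then have "\<delta> * exp (- L * s) \<le> \<delta>" using \<delta> mult_left_le by blast
    moreover have "L * norm (u s) * exp (- L * s) \<le> L * v s * exp (- L * s)"
      using le[OF s'] L by (intro mult_right_mono mult_left_mono) auto
    ultimately have "g s * exp (- L * s) - L * v s * exp (- L * s) - \<delta> \<le> 0"
      by (simp add: g_def algebra_simps)
    with 1 show "\<exists>y. DERIV w s :> y \<and> y \<le> 0" by blast
  qed
  then have "v t * exp (- L * t) \<le> norm (u 0) + \<delta> * t" by (simp add: w_def v_def)
  then have "v t \<le> (norm (u 0) + \<delta> * t) * exp (L * t)"
    by (simp add: exp_minus field_simps)
  with le[OF t] show ?thesis by linarith
qed

text \<open>Zeros spread both forward and backward in time: the squared norm of \<open>w\<close>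
  weighted by \<open>exp (- 2 * L * s)\<close> is nonincreasing, and weighted by
  \<open>exp (2 * L * s)\<close> it is nondecreasing. The inner product makes the squared norm
  differentiable.\<close>

lemma zero_propagates:
  fixes w :: "real \<Rightarrow> 'a::real_inner"
  assumes w: "\<And>t. t \<in> {0..T} \<Longrightarrow> (w has_vector_derivative w' t) (at t within {0..T})"
    and bound: "\<And>t. t \<in> {0..T} \<Longrightarrow> norm (w' t) \<le> L * norm (w t)"
    and \<tau>: "\<tau> \<in> {0..T}" "w \<tau> = 0" and t: "t \<in> {0..T}"
  shows "w t = 0"
proof -
  define g where "g c s = exp (c * s) * (w s \<bullet> w s)" for c s
  have dg: "(g c has_real_derivative exp (c * s) * (c * (w s \<bullet> w s) + 2 * (w s \<bullet> w' s))) (at s within {0..T})"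
    if "s \<in> {0..T}" for c s
  proof -
    have "((\<lambda>s. w s \<bullet> w s) has_real_derivative 2 * (w s \<bullet> w' s)) (at s within {0..T})"
      using has_derivative_inner[OF w[OF that, unfolded has_vector_derivative_def]
          w[OF that, unfolded has_vector_derivative_def]]
      unfolding has_field_derivative_def
      by (rule has_derivative_eq_rhs) (auto simp: fun_eq_iff inner_commute)
    then show ?thesis
      unfolding g_def by (auto intro!: derivative_eq_intros simp: algebra_simps)
  qed
  have cont: "continuous_on {0..T} (g c)" for c
    using DERIV_continuous_on[OF dg] by blast
  have dg': "(g c has_real_derivative exp (c * s) * (c * (w s \<bullet> w s) + 2 * (w s \<bullet> w' s))) (at s)"
    if "0 < s" "s < T" for c s
  proof -
    have "at s within {0..T} = at s"
      using that by (intro at_within_interior) auto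
    with dg[of s c] that show ?thesis by simp
  qed
  have bd: "\<bar>w s \<bullet> w' s\<bar> \<le> L * (w s \<bullet> w s)" if "s \<in> {0..T}" for s
  proof -
    have "\<bar>w s \<bullet> w' s\<bar> \<le> norm (w s) * norm (w' s)" by (rule Cauchy_Schwarz_ineq2)
    also have "\<dots> \<le> norm (w s) * (L * norm (w s))" by (intro mult_left_mono bound that) auto
    finally show ?thesis by (simp add: dot_square_norm power2_eq_square mult_ac)
  qed
  have "w t \<bullet> w t \<le> 0"
  proof (cases "\<tau> \<le> t")
    case True
    have "g (- 2 * L) t \<le> g (- 2 * L) \<tau>"
    proof (rule DERIV_nonpos_imp_decreasing_open[OF True])
      fix s assume s: "\<tau> < s" "s < t"
      then have "0 < s" "s < T" "s \<in> {0..T}" using \<tau> t by auto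
      then have "DERIV (g (- 2 * L)) s :> exp (- 2 * L * s) * (- 2 * L * (w s \<bullet> w s) + 2 * (w s \<bullet> w' s))"
          and "exp (- 2 * L * s) * (- 2 * L * (w s \<bullet> w s) + 2 * (w s \<bullet> w' s)) \<le> 0"
        using dg'[of s "- 2 * L"] bd[of s] by (auto intro!: mult_nonneg_nonpos)
      then show "\<exists>y. DERIV (g (- 2 * L)) s :> y \<and> y \<le> 0" by blast
    next
      show "continuous_on {\<tau>..t} (g (- 2 * L))" using \<tau> t by (intro continuous_on_subset[OF cont]) auto
    qed
    then show ?thesis by (simp add: g_def \<tau> mult_le_0_iff)
  next
    case False
    then have le: "t \<le> \<tau>" by simp
    have "g (2 * L) t \<le> g (2 * L) \<tau>"
    proof (rule DERIV_nonneg_imp_increasing_open[OF le])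
      fix s assume s: "t < s" "s < \<tau>"
      then have "0 < s" "s < T" "s \<in> {0..T}" using \<tau> t by auto
      then have "DERIV (g (2 * L)) s :> exp (2 * L * s) * (2 * L * (w s \<bullet> w s) + 2 * (w s \<bullet> w' s))"
          and "exp (2 * L * s) * (2 * L * (w s \<bullet> w s) + 2 * (w s \<bullet> w' s)) \<ge> 0"
        using dg'[of s "2 * L"] bd[of s] by (auto intro!: mult_nonneg_nonneg)
      then show "\<exists>y. DERIV (g (2 * L)) s :> y \<and> y \<ge> 0" by blast
    next
      show "continuous_on {t..\<tau>} (g (2 * L))" using \<tau> t by (intro continuous_on_subset[OF cont]) auto
    qed
    then show ?thesis by (simp add: g_def \<tau> mult_le_0_iff)
  qed
  then have "w t \<bullet> w t = 0" using inner_ge_zero[of "w t"] by linarith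
  then show ?thesis by simp
qed

text \<open>Banach's theorem in the complete space of bounded continuous functions. The contraction
  is stated on the half-line only, which is all that the integral operators below can
  satisfy.\<close>

lemma bounded_continuous_fixpoint:
  fixes P :: "(real \<Rightarrow> 'a::banach) \<Rightarrow> real \<Rightarrow> 'a"
  assumes P: "\<And>z. continuous_on {0..} z \<Longrightarrow> bounded (z ` {0..}) \<Longrightarrow>
      continuous_on {0..} (P z) \<and> bounded (P z ` {0..})"
    and contr: "\<And>z w b t. continuous_on {0..} z \<Longrightarrow> bounded (z ` {0..}) \<Longrightarrow>
      continuous_on {0..} w \<Longrightarrow> bounded (w ` {0..}) \<Longrightarrow>
      (\<And>s. s \<ge> 0 \<Longrightarrow> norm (z s - w s) \<le> b) \<Longrightarrow> t \<ge> 0 \<Longrightarrow> norm (P z t - P w t) \<le> q * b"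
    and q: "0 \<le> q" "q < 1"
  obtains y where "continuous_on {0..} y" "\<And>t. t \<ge> 0 \<Longrightarrow> y t = P y t"
proof -
  \<comment> \<open>The type \<open>bcontfun\<close> needs a function on the whole line;
    \<open>max 0 t\<close> extends the image by its value at 0.\<close>
  define T where "T z = Bcontfun (\<lambda>t. P (apply_bcontfun z) (max 0 t))" for z :: "real \<Rightarrow>\<^sub>C 'a"
  have adm: "continuous_on {0..} (apply_bcontfun z)" "bounded (apply_bcontfun z ` {0..})"
    for z :: "real \<Rightarrow>\<^sub>C 'a"
    by (auto intro: bounded_subset[OF bounded_apply_bcontfun])
  have T: "apply_bcontfun (T z) t = P (apply_bcontfun z) (max 0 t)" for z t
  proof -
    have "continuous_on UNIV (\<lambda>t. P (apply_bcontfun z) (max 0 t))"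
    proof (rule continuous_on_compose2[of "{0..}" "P (apply_bcontfun z)" UNIV "\<lambda>t::real. max 0 t"])
      show "continuous_on {0..} (P z)" using P[OF adm[of z]] by blast
      show "continuous_on UNIV (\<lambda>t::real. max 0 t)" by (intro continuous_intros)
    qed auto
    moreover have "bounded (range (\<lambda>t. P (apply_bcontfun z) (max 0 t)))"
      using P[OF adm[of z]] by (elim conjE bounded_subset) auto
    ultimately have "(\<lambda>t. P (apply_bcontfun z) (max 0 t)) \<in> bcontfun" by (simp add: bcontfun_def)
    then show ?thesis by (simp add: T_def Bcontfun_inverse)
  qed
  have "dist (T z) (T w) \<le> q * dist z w" for z w
  proof (rule dist_bound)
    fix t
    have "norm (apply_bcontfun z s - apply_bcontfun w s) \<le> dist z w" for s
      using dist_bounded[of z s w] by (simp add: dist_norm)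
    then have "norm (P z (max 0 t) - P w (max 0 t)) \<le> q * dist z w"
      by (intro contr adm) auto
    then show "dist (apply_bcontfun (T z) t) (apply_bcontfun (T w) t) \<le> q * dist z w"
      by (simp add: T dist_norm)
  qed
  then obtain z where z: "T z = z" using banach_fix_type[OF q, of T] by blast
  show thesis
  proof (rule that[of "apply_bcontfun z"])
    show "apply_bcontfun z t = P z t" if "t \<ge> 0" for t
      using T[of z t] that by (simp add: z)
  qed (rule adm)
qed

text \<open>The exponential weight turns the integral equation on \<open>[0, \<infinity>)\<close> into a contraction with
  constant \<open>1 / 2\<close>.\<close>

lemma lipschitz_ode_exists:
  fixes F :: "real \<Rightarrow> 'a::banach \<Rightarrow> 'a"
  assumes F: "continuous_on ({0..} \<times> UNIV) (\<lambda>(t, x). F t x)"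
    and F0: "\<And>t. t \<ge> 0 \<Longrightarrow> F t 0 = 0"
    and k: "continuous_on {0..} k" "\<And>t. t \<ge> 0 \<Longrightarrow> 0 \<le> k t"
    and lip: "\<And>t x y. t \<ge> 0 \<Longrightarrow> norm (F t x - F t y) \<le> k t * norm (x - y)"
  obtains x where "x 0 = x0" "solves_ode F x"
proof -
  \<comment> \<open>Because \<open>K' = 2 * k\<close>, the integral of \<open>k * exp K\<close> up
    to \<open>t\<close> is at most \<open>exp (K t) / 2\<close>; the 2 is the source of the
    contraction constant.\<close>
  define K where "K t = 2 * integral {0..t} k" for t
  have dK: "(K has_vector_derivative 2 * k t) (at t within {0..})" if "t \<ge> 0" for t
    unfolding K_def using has_vector_derivative_integral_atLeast[OF k(1) that]
    by (auto intro!: has_vector_derivative_mult_right)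
  then have contK: "continuous_on {0..} K"
    by (intro has_vector_derivative_imp_continuous_on) auto
  have Kpos: "K t \<ge> 0" for t
    unfolding K_def by (auto intro!: integral_nonneg integrable_continuous_real continuous_on_subset[OF k(1)] k(2))
  have FK: "continuous_on {0..} (\<lambda>s. F s (exp (K s) *\<^sub>R z s))" if "continuous_on {0..} z" for z
  proof -
    have "continuous_on {0..} (\<lambda>s. (s, exp (K s) *\<^sub>R z s))"
      by (intro continuous_intros contK that)
    from continuous_on_compose2[OF F this] show ?thesis by auto
  qed
  \<comment> \<open>The Picard operator in the rescaled unknown: a fixed point \<open>z\<close>
    corresponds to the solution \<open>exp (K t) *\<^sub>R z t\<close>.\<close>
  define P where "P z t = exp (- K t) *\<^sub>R (x0 + integral {0..t} (\<lambda>s. F s (exp (K s) *\<^sub>R z s)))" for z t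
  have contr: "norm (P z t - P w t) \<le> 1 / 2 * b"
    if z: "continuous_on {0..} z" and w: "continuous_on {0..} w"
      and b: "\<And>s. s \<ge> 0 \<Longrightarrow> norm (z s - w s) \<le> b" and t: "t \<ge> 0" for z w b t
  proof -
    let ?d = "\<lambda>s. F s (exp (K s) *\<^sub>R z s) - F s (exp (K s) *\<^sub>R w s)"
    have b0: "b \<ge> 0" using b[of 0] norm_ge_zero order_trans by blast
    have int: "(\<lambda>s. F s (exp (K s) *\<^sub>R z s)) integrable_on {0..t}" if "continuous_on {0..} z" for z
      using FK[OF that] by (intro integrable_continuous_real continuous_on_subset[OF FK[OF that]]) auto
    have hi: "((\<lambda>s. k s * exp (K s) * b) has_integral (exp (K t) / 2 * b - exp (K 0) / 2 * b)) {0..t}"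
    proof (rule fundamental_theorem_of_calculus[OF t])
      fix s assume s: "s \<in> {0..t}"
      have "(K has_real_derivative 2 * k s) (at s within {0..t})"
        unfolding has_real_derivative_iff_has_vector_derivative
        using s by (intro has_vector_derivative_within_subset[OF dK]) auto
      then show "((\<lambda>s. exp (K s) / 2 * b) has_vector_derivative k s * exp (K s) * b) (at s within {0..t})"
        unfolding has_real_derivative_iff_has_vector_derivative[symmetric]
        by (auto intro!: derivative_eq_intros)
    qed
    have "norm (integral {0..t} ?d) \<le> integral {0..t} (\<lambda>s. k s * exp (K s) * b)"
    proof (rule integral_norm_bound_integral)
      show "?d integrable_on {0..t}" by (intro integrable_diff int z w)
      show "(\<lambda>s. k s * exp (K s) * b) integrable_on {0..t}" using hi by blast
      fix s assume s: "s \<in> {0..t}"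
      have "norm (?d s) \<le> k s * norm (exp (K s) *\<^sub>R z s - exp (K s) *\<^sub>R w s)" using lip s by auto
      also have "\<dots> = k s * exp (K s) * norm (z s - w s)" by (simp flip: scaleR_diff_right)
      also have "\<dots> \<le> k s * exp (K s) * b"
        using s k(2) by (intro mult_left_mono b) auto
      finally show "norm (?d s) \<le> k s * exp (K s) * b" .
    qed
    also have "\<dots> \<le> exp (K t) / 2 * b"
      unfolding integral_unique[OF hi] using b0 by simp
    finally have "exp (- K t) * norm (integral {0..t} ?d) \<le> exp (- K t) * (exp (K t) / 2 * b)"
      by (intro mult_left_mono) auto
    moreover have "P z t - P w t = exp (- K t) *\<^sub>R integral {0..t} ?d"
      by (simp add: P_def integral_diff int z w flip: scaleR_diff_right)
    ultimately show ?thesis by (simp add: exp_minus field_simps)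
  qed
  obtain y where y: "continuous_on {0..} y" "\<And>t. t \<ge> 0 \<Longrightarrow> y t = P y t"
  proof (rule bounded_continuous_fixpoint[of P "1 / 2"])
    fix z :: "real \<Rightarrow> 'a" assume z: "continuous_on {0..} z" "bounded (z ` {0..})"
    have "continuous_on {0..} (\<lambda>t. integral {0..t} (\<lambda>s. F s (exp (K s) *\<^sub>R z s)))"
      using has_vector_derivative_integral_atLeast[OF FK[OF z(1)]]
      by (intro has_vector_derivative_imp_continuous_on) auto
    then have "continuous_on {0..} (P z)"
      unfolding P_def by (intro continuous_intros contK)
    moreover obtain B where B: "\<And>s. s \<ge> 0 \<Longrightarrow> norm (z s) \<le> B"
      using z(2) by (auto simp: bounded_iff)
    \<comment> \<open>By \<open>F0\<close> the zero function is sent to a bounded function, and the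
      contraction estimate carries boundedness over to every bounded \<open>z\<close>.\<close>
    have "norm (P z t) \<le> norm x0 + 1 / 2 * B" if t: "t \<ge> 0" for t
    proof -
      have "P (\<lambda>_. 0) t = exp (- K t) *\<^sub>R x0"
        by (simp add: P_def) (subst integral_cong[where g="\<lambda>_. 0"], auto simp: F0)
      moreover have "norm (exp (- K t) *\<^sub>R x0) \<le> norm x0"
        using Kpos[of t] by (simp add: mult_left_le_one_le)
      moreover have "norm (P z t - P (\<lambda>_. 0) t) \<le> 1 / 2 * B"
        using B by (intro contr z t continuous_intros) auto
      ultimately show ?thesis using norm_triangle_sub[of "P z t" "P (\<lambda>_. 0) t"] by simp
    qed
    then have "bounded (P z ` {0..})" by (auto simp: bounded_iff)
    ultimately show "continuous_on {0..} (P z) \<and> bounded (P z ` {0..})" by blast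
  qed (use contr in auto)
  define x where "x t = x0 + integral {0..t} (\<lambda>s. F s (exp (K s) *\<^sub>R y s))" for t
  have xy: "exp (K t) *\<^sub>R y t = x t" if "t \<ge> 0" for t
    using y(2)[OF that] by (simp add: P_def x_def exp_minus)
  show thesis
  proof (rule that[of x])
    show "x 0 = x0" by (simp add: x_def)
    show "solves_ode F x"
      unfolding solves_ode_def
    proof (intro allI impI)
      fix t :: real assume t: "t \<ge> 0"
      have "(x has_vector_derivative F t (exp (K t) *\<^sub>R y t)) (at t within {0..})"
        unfolding x_def
        by (auto intro!: derivative_eq_intros has_vector_derivative_integral_atLeast FK y t)
      then show "(x has_vector_derivative F t (x t)) (at t within {0..})" by (simp add: xy t)
    qed
  qed
qed

section \<open>Dependence on initial values\<close>

text \<open>Separate continuity becomes joint continuity because the state estimate is uniform over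
  compact time intervals. It is used up to \<open>t + 1\<close>, so that nearby later times are
  covered too.\<close>

lemma continuous_on_time_stateI:
  fixes H :: "real \<Rightarrow> 'a::real_normed_vector \<Rightarrow> 'b::real_normed_vector"
  assumes time: "\<And>\<xi>. continuous_on {0..} (\<lambda>t. H t \<xi>)"
    and state: "\<And>T \<xi> \<epsilon>. T \<ge> 0 \<Longrightarrow> \<epsilon> > 0 \<Longrightarrow>
      \<exists>\<delta>>0. \<forall>\<zeta>. norm (\<zeta> - \<xi>) < \<delta> \<longrightarrow> (\<forall>t\<in>{0..T}. norm (H t \<zeta> - H t \<xi>) \<le> \<epsilon>)"
  shows "continuous_on ({0..} \<times> UNIV) (\<lambda>(t, \<xi>). H t \<xi>)"
  unfolding continuous_on_iff
proof (intro ballI allI impI)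
  fix p :: "real \<times> 'a" and e :: real
  assume p: "p \<in> {0..} \<times> UNIV" and e: "e > 0"
  obtain t \<xi> where p_eq: "p = (t, \<xi>)" and t: "t \<ge> 0" using p by auto
  obtain \<delta>1 where \<delta>1: "\<delta>1 > 0"
    "\<And>\<zeta> s. norm (\<zeta> - \<xi>) < \<delta>1 \<Longrightarrow> s \<in> {0..t + 1} \<Longrightarrow> norm (H s \<zeta> - H s \<xi>) \<le> e / 3"
    using state[of "t + 1" "e / 3" \<xi>] t e by auto
  obtain \<delta>2 where \<delta>2: "\<delta>2 > 0" "\<And>s. s \<ge> 0 \<Longrightarrow> dist s t < \<delta>2 \<Longrightarrow> dist (H s \<xi>) (H t \<xi>) < e / 3"
    using time[of \<xi>, unfolded continuous_on_iff, rule_format, of t "e / 3"] t e by auto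
  show "\<exists>d>0. \<forall>q\<in>{0..} \<times> UNIV. dist q p < d \<longrightarrow>
      dist (case q of (t, \<xi>) \<Rightarrow> H t \<xi>) (case p of (t, \<xi>) \<Rightarrow> H t \<xi>) < e"
  proof (intro exI[of _ "min 1 (min \<delta>1 \<delta>2)"] conjI ballI impI)
    show "0 < min 1 (min \<delta>1 \<delta>2)" using \<delta>1 \<delta>2 by simp
    fix q :: "real \<times> 'a" assume q: "q \<in> {0..} \<times> UNIV" and d: "dist q p < min 1 (min \<delta>1 \<delta>2)"
    obtain s \<zeta> where q_eq: "q = (s, \<zeta>)" and s: "s \<ge> 0" using q by auto
    have ds: "dist s t < 1" "dist s t < \<delta>2" and d\<zeta>: "dist \<zeta> \<xi> < \<delta>1"
      using d dist_fst_le[of q p] dist_snd_le[of q p] by (auto simp: p_eq q_eq)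
    have "norm (H s \<zeta> - H s \<xi>) \<le> e / 3"
      using ds d\<zeta> s by (intro \<delta>1(2)) (auto simp: dist_norm)
    moreover have "dist (H s \<xi>) (H t \<xi>) < e / 3" using \<delta>2(2) s ds by simp
    ultimately have "dist (H s \<zeta>) (H t \<xi>) < e"
      using dist_triangle[of "H s \<zeta>" "H t \<xi>" "H s \<xi>"] e by (simp add: dist_norm)
    then show "dist (case q of (t, \<xi>) \<Rightarrow> H t \<xi>) (case p of (t, \<xi>) \<Rightarrow> H t \<xi>) < e"
      by (simp add: p_eq q_eq)
  qed
qed

lemma norm_blinfun_le: "norm V \<le> L \<Longrightarrow> norm (blinfun_apply V v) \<le> L * norm v"
  using norm_blinfun[of V v] mult_right_mono[of "norm V" L "norm v"] by simp

section \<open>Vector fields with a jointly continuous state derivative\<close>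

locale C1_field =
  fixes F :: "real \<Rightarrow> 'a::euclidean_space \<Rightarrow> 'a"
    and F' :: "real \<Rightarrow> 'a \<Rightarrow> 'a \<Rightarrow>\<^sub>L 'a"
  assumes F_cont: "continuous_on ({0..} \<times> UNIV) (\<lambda>(t, y). F t y)"
    and F_deriv: "t \<ge> 0 \<Longrightarrow> (F t has_derivative blinfun_apply (F' t y)) (at y)"
    and F'_cont: "continuous_on ({0..} \<times> UNIV) (\<lambda>(t, y). F' t y)"
begin

lemma F'_along:
  assumes "continuous_on S x" "continuous_on S \<tau>" "\<And>s. s \<in> S \<Longrightarrow> \<tau> s \<ge> 0"
  shows "continuous_on S (\<lambda>s. F' (\<tau> s) (x s))"
proof -
  have "continuous_on S (\<lambda>s. (\<tau> s, x s))" by (intro continuous_intros assms)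
  from continuous_on_compose2[OF F'_cont this] show ?thesis using assms(3) by auto
qed

lemma F_along:
  assumes "continuous_on S x" "continuous_on S \<tau>" "\<And>s. s \<in> S \<Longrightarrow> \<tau> s \<ge> 0"
  shows "continuous_on S (\<lambda>s. F (\<tau> s) (x s))"
proof -
  have "continuous_on S (\<lambda>s. (\<tau> s, x s))" by (intro continuous_intros assms)
  from continuous_on_compose2[OF F_cont this] show ?thesis using assms(3) by auto
qed

lemma F'_bounded_along:
  assumes "continuous_on {0..T} x"
  obtains L where "L \<ge> 0" "\<And>t. t \<in> {0..T} \<Longrightarrow> norm (F' t (x t)) \<le> L"
proof -
  have "compact ((\<lambda>t. F' t (x t)) ` {0..T})"
    by (intro compact_continuous_image F'_along assms continuous_intros) auto
  from compact_imp_bounded[OF this]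
  obtain L where L: "\<forall>V \<in> (\<lambda>t. F' t (x t)) ` {0..T}. norm V \<le> L"
    unfolding bounded_iff ..
  show thesis
  proof (rule that[of "max 0 L"])
    show "norm (F' t (x t)) \<le> max 0 L" if "t \<in> {0..T}" for t
      using L that by (intro max.coboundedI2) blast
  qed simp
qed

text \<open>Compactness gives one radius \<open>\<delta>\<close> for all times. The mean value
  inequality then converts closeness of the derivatives into a first-order Taylor estimate that is
  uniform along the trajectory.\<close>

lemma tube:
  assumes x: "continuous_on {0..T} x" and \<epsilon>: "\<epsilon> > 0"
  obtains \<delta> where "\<delta> > 0"
    "\<And>t y. t \<in> {0..T} \<Longrightarrow> norm (y - x t) \<le> \<delta> \<Longrightarrow> norm (F' t y - F' t (x t)) \<le> \<epsilon>"
    "\<And>t y. t \<in> {0..T} \<Longrightarrow> norm (y - x t) \<le> \<delta> \<Longrightarrow>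
       norm (F t y - F t (x t) - F' t (x t) (y - x t)) \<le> norm (y - x t) * \<epsilon>"
proof -
  \<comment> \<open>Coordinates relative to the trajectory turn the tube into a product of compact
    sets.\<close>
  define K where "K = {0..T} \<times> cball (0::'a) 1"
  define g where "g p = F' (fst p) (x (fst p) + snd p)" for p :: "real \<times> 'a"
  have "continuous_on K g"
    unfolding g_def K_def
    by (intro F'_along continuous_intros continuous_on_compose2[OF x]) auto
  then have "uniformly_continuous_on K g"
    by (intro compact_uniformly_continuous) (auto simp: K_def compact_Times)
  then obtain d where d: "d > 0" "\<And>p q. p \<in> K \<Longrightarrow> q \<in> K \<Longrightarrow> dist q p < d \<Longrightarrow> dist (g q) (g p) < \<epsilon>"
    using \<epsilon> unfolding uniformly_continuous_on_def by blast
  \<comment> \<open>The half provides the strict inequality that uniform continuity asks for; the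
    cap 1 keeps the points inside \<open>K\<close>.\<close>
  define \<delta> where "\<delta> = min (d / 2) 1"
  have \<delta>: "\<delta> > 0" "\<delta> < d" "\<delta> \<le> 1" using d by (auto simp: \<delta>_def)
  have 1: "norm (F' t y - F' t (x t)) \<le> \<epsilon>" if "t \<in> {0..T}" "norm (y - x t) \<le> \<delta>" for t y
    using d(2)[of "(t, 0)" "(t, y - x t)"] that \<delta>
    by (simp add: K_def g_def dist_Pair_Pair dist_norm norm_minus_commute[of "x t"])
  show thesis
  proof (rule that[OF \<delta>(1) 1])
    fix t y assume t: "t \<in> {0..T}" and y: "norm (y - x t) \<le> \<delta>"
    show "norm (F t y - F t (x t) - F' t (x t) (y - x t)) \<le> norm (y - x t) * \<epsilon>"
    proof (rule differentiable_bound_linearization[where S="cball (x t) \<delta>" and f'="\<lambda>z. blinfun_apply (F' t z)"])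
      show "x t + s *\<^sub>R (y - x t) \<in> cball (x t) \<delta>" if "s \<in> {0..1}" for s
      proof -
        have "s * norm (y - x t) \<le> norm (y - x t)" using that by (intro mult_left_le_one_le) auto
        then show ?thesis using that y by (simp add: dist_norm)
      qed
      show "(F t has_derivative blinfun_apply (F' t z)) (at z within cball (x t) \<delta>)" for z
        using t by (auto intro: has_derivative_at_withinI[OF F_deriv])
      show "onorm (blinfun_apply (F' t z) - blinfun_apply (F' t (x t))) \<le> \<epsilon>" if "z \<in> cball (x t) \<delta>" for z
      proof -
        have "norm (z - x t) \<le> \<delta>" using that by (simp add: dist_norm norm_minus_commute)
        from 1[OF t this] show ?thesis
          by (simp add: norm_blinfun.rep_eq minus_blinfun.rep_eq fun_diff_def)
      qed
    qed (use \<delta> in auto)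
  qed auto
qed

text \<open>Up to time \<open>T\<close> both curves stay in one ball, on which \<open>F'\<close> is
  bounded by compactness. The mean value inequality then supplies the Lipschitz constant for
  \<open>zero_propagates\<close>, on either side of \<open>\<tau>\<close>.\<close>

lemma unique:
  assumes x: "solves_ode F x" and y: "solves_ode F y"
    and eq: "x \<tau> = y \<tau>" and \<tau>: "\<tau> \<ge> 0" and t: "t \<ge> 0"
  shows "x t = y t"
proof -
  define T where "T = max \<tau> t"
  have cx: "continuous_on {0..T} x" and cy: "continuous_on {0..T} y"
    using x y by (auto intro: continuous_on_subset[OF solves_ode_continuous_on])
  have "bounded (x ` {0..T} \<union> y ` {0..T})"
    by (intro bounded_Un[THEN iffD2] conjI compact_imp_bounded compact_continuous_image cx cy) auto
  then obtain R where "\<forall>z \<in> x ` {0..T} \<union> y ` {0..T}. norm z \<le> R"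
    unfolding bounded_iff ..
  then have R: "x s \<in> cball 0 R \<and> y s \<in> cball 0 R" if "s \<in> {0..T}" for s
    using that by auto
  have "compact ((\<lambda>p. F' (fst p) (snd p)) ` ({0..T} \<times> cball 0 R))"
    by (intro compact_continuous_image F'_along continuous_intros compact_Times) auto
  from compact_imp_bounded[OF this]
  obtain L where "\<forall>V \<in> (\<lambda>p. F' (fst p) (snd p)) ` ({0..T} \<times> cball 0 R). norm V \<le> L"
    unfolding bounded_iff ..
  then have L: "norm (F' s z) \<le> L" if "s \<in> {0..T}" "z \<in> cball 0 R" for s z
    using that by force
  have "x t - y t = 0"
  proof (rule zero_propagates[where T=T and L=L and w="\<lambda>s. x s - y s" and \<tau>=\<tau>])
    show "((\<lambda>s. x s - y s) has_vector_derivative F s (x s) - F s (y s)) (at s within {0..T})"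
      if "s \<in> {0..T}" for s
      by (intro has_vector_derivative_diff solves_ode_within x y that)
    show "norm (F s (x s) - F s (y s)) \<le> L * norm (x s - y s)" if s: "s \<in> {0..T}" for s
    proof (rule differentiable_bound[where S="cball 0 R" and f'="\<lambda>z. blinfun_apply (F' s z)"])
      show "(F s has_derivative blinfun_apply (F' s z)) (at z within cball 0 R)" for z
        using s by (auto intro: has_derivative_at_withinI[OF F_deriv])
      show "onorm (blinfun_apply (F' s z)) \<le> L" if "z \<in> cball 0 R" for z
        using L[OF s that] by (simp add: norm_blinfun.rep_eq)
    qed (use R[OF s] in auto)
  qed (use \<tau> t eq in \<open>auto simp: T_def\<close>)
  then show ?thesis by simp
qed

end

section \<open>The flow and its first variation\<close>

locale C1_flow = C1_field F F' for F :: "real \<Rightarrow> 'a::euclidean_space \<Rightarrow> 'a" and F' +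
  fixes \<Phi> :: "real \<Rightarrow> 'a \<Rightarrow> 'a"
  assumes \<Phi>_solves: "solves_ode F (\<lambda>t. \<Phi> t \<xi>)" and \<Phi>_0: "\<Phi> 0 \<xi> = \<xi>"
begin

lemma \<Phi>_time_cont: "S \<subseteq> {0..} \<Longrightarrow> continuous_on S (\<lambda>t. \<Phi> t \<xi>)"
  using solves_ode_continuous_on[OF \<Phi>_solves] continuous_on_subset by blast

text \<open>A continuation argument: the Lipschitz estimate for \<open>F\<close> is available only
  inside the tube, and Gronwall's bound, valid as long as the perturbed trajectory stays inside,
  prevents it from ever reaching the boundary.\<close>

lemma locally_lipschitz:
  assumes T: "T \<ge> 0"
  obtains C \<delta> where "C > 0" "\<delta> > 0"
    "\<And>\<zeta> t. norm (\<zeta> - \<xi>) < \<delta> \<Longrightarrow> t \<in> {0..T} \<Longrightarrow> norm (\<Phi> t \<zeta> - \<Phi> t \<xi>) \<le> C * norm (\<zeta> - \<xi>)"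
proof -
  have x: "continuous_on {0..T} (\<lambda>t. \<Phi> t \<xi>)" by (rule \<Phi>_time_cont) auto
  obtain \<delta>1 where \<delta>1: "\<delta>1 > 0" "\<And>t y. t \<in> {0..T} \<Longrightarrow> norm (y - \<Phi> t \<xi>) \<le> \<delta>1 \<Longrightarrow>
       norm (F t y - F t (\<Phi> t \<xi>) - F' t (\<Phi> t \<xi>) (y - \<Phi> t \<xi>)) \<le> norm (y - \<Phi> t \<xi>) * 1"
    by (rule tube[OF x, of 1]) auto
  obtain L where L: "L \<ge> 0" "\<And>t. t \<in> {0..T} \<Longrightarrow> norm (F' t (\<Phi> t \<xi>)) \<le> L"
    using F'_bounded_along[OF x] by blast
  have lip: "norm (F t y - F t (\<Phi> t \<xi>)) \<le> (L + 1) * norm (y - \<Phi> t \<xi>) + 0"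
    if "t \<in> {0..T}" "norm (y - \<Phi> t \<xi>) \<le> \<delta>1" for t y
  proof -
    have "norm (F' t (\<Phi> t \<xi>) (y - \<Phi> t \<xi>)) \<le> L * norm (y - \<Phi> t \<xi>)"
      using L(2)[OF that(1)] by (rule norm_blinfun_le)
    with \<delta>1(2)[OF that] show ?thesis
      using norm_triangle_sub[of "F t y - F t (\<Phi> t \<xi>)" "F' t (\<Phi> t \<xi>) (y - \<Phi> t \<xi>)"]
      by (simp add: algebra_simps)
  qed
  \<comment> \<open>Gronwall's factor for the constant \<open>L + 1\<close>, in which
    \<open>L\<close> bounds the derivative along the trajectory and 1 is the tolerance chosen for
    the tube. Initial distances below \<open>\<delta>1 / C\<close> then never grow to
    \<open>\<delta>1\<close>.\<close>
  define C where "C = exp ((L + 1) * T)"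
  have C: "C > 0" by (simp add: C_def)
  show thesis
  proof (rule that[of C "\<delta>1 / C"])
    fix \<zeta> t assume \<zeta>: "norm (\<zeta> - \<xi>) < \<delta>1 / C" and t: "t \<in> {0..T}"
    define u where "u s = \<Phi> s \<zeta> - \<Phi> s \<xi>" for s
    have du: "(u has_vector_derivative F s (\<Phi> s \<zeta>) - F s (\<Phi> s \<xi>)) (at s within {0..r})"
      if "s \<in> {0..r}" for s r
      unfolding u_def by (intro has_vector_derivative_diff solves_ode_within \<Phi>_solves that)
    have step: "norm (u r) \<le> C * norm (\<zeta> - \<xi>)"
      if r: "r \<in> {0..T}" and small: "\<And>s. s \<in> {0..r} \<Longrightarrow> norm (u s) \<le> \<delta>1" for r
    proof -
      have "norm (u r) \<le> (norm (u 0) + 0 * r) * exp ((L + 1) * r)"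
      proof (rule gronwall[OF du])
        show "norm (F s (\<Phi> s \<zeta>) - F s (\<Phi> s \<xi>)) \<le> (L + 1) * norm (u s) + 0" if "s \<in> {0..r}" for s
          unfolding u_def using r that small[OF that] by (intro lip) (auto simp: u_def)
      qed (use r L(1) in auto)
      also have "\<dots> \<le> norm (u 0) * C"
      proof -
        have "(L + 1) * r \<le> (L + 1) * T" using r L(1) by (intro mult_left_mono) auto
        then show ?thesis by (simp add: C_def mult_left_mono)
      qed
      finally show ?thesis by (simp add: u_def \<Phi>_0 mult.commute)
    qed
    have less: "C * norm (\<zeta> - \<xi>) < \<delta>1" using \<zeta> C by (simp add: field_simps)
    have contu: "continuous_on {0..T} (\<lambda>s. norm (u s))"
      unfolding u_def by (intro continuous_intros \<Phi>_time_cont) auto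
    have "norm (u s) < \<delta>1" if s: "s \<in> {0..T}" for s
    proof (rule ccontr)
      assume "\<not> norm (u s) < \<delta>1"
      \<comment> \<open>The times at which the perturbed trajectory has left the open tube. This set
        is compact, so a first such time \<open>r\<close> exists, and it is positive.\<close>
      define S where "S = {0..T} \<inter> {s. \<delta>1 \<le> norm (u s)}"
      have "closed ({0..T} \<inter> (\<lambda>s. norm (u s)) -` {\<delta>1..})"
        by (rule continuous_closed_preimage[OF contu]) auto
      then have "closed S" by (simp only: S_def vimage_def atLeast_iff)
      moreover have "bounded S" by (rule bounded_subset[of "{0..T}"]) (auto simp: S_def)
      ultimately have "compact S" by (simp only: compact_eq_bounded_closed)
      moreover have "S \<noteq> {}" using s \<open>\<not> norm (u s) < \<delta>1\<close> by (auto simp: S_def)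
      ultimately obtain r where r: "r \<in> S" "\<forall>s\<in>S. r \<le> s"
        by (rule compact_attains_inf[THEN bexE])
      have rT: "r \<in> {0..T}" using r by (auto simp: S_def)
      have "norm (u 0) < \<delta>1"
      proof -
        have "1 \<le> C" using T L(1) by (simp add: C_def)
        then have "norm (\<zeta> - \<xi>) \<le> C * norm (\<zeta> - \<xi>)"
          using mult_right_mono[of 1 C "norm (\<zeta> - \<xi>)"] by simp
        with less show ?thesis by (simp add: u_def \<Phi>_0)
      qed
      then have "r \<noteq> 0" using r by (auto simp: S_def)
      then have r0: "r > 0" using rT by auto
      \<comment> \<open>Before \<open>r\<close> the trajectory is inside the tube, and continuity
        extends the weak bound to \<open>r\<close> itself. So \<open>step\<close> applies at
        \<open>r\<close> and gives a value strictly below \<open>\<delta>1\<close>, a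
        contradiction.\<close>
      have "norm (u q) \<le> \<delta>1" if q: "q \<in> {0..r}" for q
      proof (rule continuous_le_on_closure[where S="{0..<r}" and f="\<lambda>s. norm (u s)"])
        show "continuous_on (closure {0..<r}) (\<lambda>s. norm (u s))"
          using r0 rT by (intro continuous_on_subset[OF contu]) auto
        show "q \<in> closure {0..<r}" using r0 q by simp
        show "norm (u s) \<le> \<delta>1" if "s \<in> {0..<r}" for s
        proof (rule ccontr)
          assume "\<not> norm (u s) \<le> \<delta>1"
          then have "s \<in> S" using that rT by (auto simp: S_def)
          from bspec[OF r(2) this] that show False by simp
        qed
      qed
      from step[OF rT this] less r(1) show False by (auto simp: S_def)
    qed
    then have "norm (u t) \<le> C * norm (\<zeta> - \<xi>)"
      using t by (intro step less_imp_le) auto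
    then show "norm (\<Phi> t \<zeta> - \<Phi> t \<xi>) \<le> C * norm (\<zeta> - \<xi>)" by (simp add: u_def)
  qed (use C \<delta>1 in auto)
qed

lemma \<Phi>_cont: "continuous_on ({0..} \<times> UNIV) (\<lambda>(t, \<xi>). \<Phi> t \<xi>)"
proof (rule continuous_on_time_stateI)
  fix T \<epsilon> :: real and \<xi> assume T: "T \<ge> 0" and \<epsilon>: "\<epsilon> > 0"
  obtain C \<delta> where C: "C > 0" "\<delta> > 0"
    "\<And>\<zeta> t. norm (\<zeta> - \<xi>) < \<delta> \<Longrightarrow> t \<in> {0..T} \<Longrightarrow> norm (\<Phi> t \<zeta> - \<Phi> t \<xi>) \<le> C * norm (\<zeta> - \<xi>)"
    using locally_lipschitz[OF T] by metis
  show "\<exists>\<delta>>0. \<forall>\<zeta>. norm (\<zeta> - \<xi>) < \<delta> \<longrightarrow> (\<forall>t\<in>{0..T}. norm (\<Phi> t \<zeta> - \<Phi> t \<xi>) \<le> \<epsilon>)"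
  proof (intro exI[of _ "min \<delta> (\<epsilon> / C)"] conjI allI impI ballI)
    fix \<zeta> t assume "norm (\<zeta> - \<xi>) < min \<delta> (\<epsilon> / C)" and t: "t \<in> {0..T}"
    then have "norm (\<zeta> - \<xi>) < \<delta>" "C * norm (\<zeta> - \<xi>) < \<epsilon>" using C by (auto simp: field_simps)
    with C(3)[OF this(1) t] show "norm (\<Phi> t \<zeta> - \<Phi> t \<xi>) \<le> \<epsilon>" by simp
  qed (use C \<epsilon> in auto)
qed (rule \<Phi>_time_cont, simp)

text \<open>The principal solution of the variational equation along the trajectory, the candidate
  for the state derivative of the flow. It is operator-valued so that one solution serves all
  directions.\<close>

definition W :: "real \<Rightarrow> 'a \<Rightarrow> 'a \<Rightarrow>\<^sub>L 'a" where
  "W t \<xi> = (SOME w. w 0 = id_blinfun \<and> solves_ode (\<lambda>t V. F' t (\<Phi> t \<xi>) o\<^sub>L V) w) t"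

text \<open>The variational equation is linear in \<open>V\<close>, so the norm of \<open>F'\<close>
  along the trajectory is a global, time-dependent Lipschitz constant and the solution exists for
  all times.\<close>

lemma W_0: "W 0 \<xi> = id_blinfun"
  and W_solves: "solves_ode (\<lambda>t V. F' t (\<Phi> t \<xi>) o\<^sub>L V) (\<lambda>t. W t \<xi>)"
proof -
  have cont: "continuous_on {0..} (\<lambda>t. F' t (\<Phi> t \<xi>))"
    by (intro F'_along \<Phi>_time_cont continuous_intros) auto
  have "\<exists>w. w 0 = id_blinfun \<and> solves_ode (\<lambda>t V. F' t (\<Phi> t \<xi>) o\<^sub>L V) w"
  proof (rule lipschitz_ode_exists[where F="\<lambda>t V. F' t (\<Phi> t \<xi>) o\<^sub>L V"
        and k="\<lambda>t. norm (F' t (\<Phi> t \<xi>))" and ?x0.0="id_blinfun :: 'a \<Rightarrow>\<^sub>L 'a"])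
    have "continuous_on ({0..} \<times> UNIV) (\<lambda>p. F' (fst p) (\<Phi> (fst p) \<xi>) o\<^sub>L (snd p :: 'a \<Rightarrow>\<^sub>L 'a))"
      by (intro bounded_bilinear.continuous_on[OF bounded_bilinear_blinfun_compose]
          continuous_on_compose2[OF cont] continuous_intros) auto
    then show "continuous_on ({0..} \<times> UNIV) (\<lambda>(t, V :: 'a \<Rightarrow>\<^sub>L 'a). F' t (\<Phi> t \<xi>) o\<^sub>L V)"
      by (simp add: case_prod_beta)
    show "norm ((F' t (\<Phi> t \<xi>) o\<^sub>L V) - (F' t (\<Phi> t \<xi>) o\<^sub>L U)) \<le> norm (F' t (\<Phi> t \<xi>)) * norm (V - U)"
      for t and U V :: "'a \<Rightarrow>\<^sub>L 'a"
      using norm_blinfun_compose[of "F' t (\<Phi> t \<xi>)" "V - U"]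
      by (simp add: bounded_bilinear.diff_right[OF bounded_bilinear_blinfun_compose])
  qed (auto intro!: continuous_intros cont
      simp: bounded_bilinear.zero_right[OF bounded_bilinear_blinfun_compose])
  from someI_ex[OF this] show "W 0 \<xi> = id_blinfun"
    "solves_ode (\<lambda>t V. F' t (\<Phi> t \<xi>) o\<^sub>L V) (\<lambda>t. W t \<xi>)"
    by (simp_all add: W_def)
qed

lemma W_time_cont: "S \<subseteq> {0..} \<Longrightarrow> continuous_on S (\<lambda>t. W t \<xi>)"
  using solves_ode_continuous_on[OF W_solves] continuous_on_subset by blast

text \<open>The remainder \<open>R\<close> of the linearization solves the variational equation up
  to a forcing that \<open>tube\<close> makes small relative to
  \<open>norm (\<zeta> - \<xi>)\<close>, and it starts at 0. Gronwall's inequality keeps it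
  small.\<close>

lemma \<Phi>_deriv:
  assumes t: "t \<ge> 0"
  shows "(\<Phi> t has_derivative blinfun_apply (W t \<xi>)) (at \<xi>)"
  unfolding has_derivative_at_alt
proof (intro conjI allI impI)
  fix e :: real assume e: "e > 0"
  have x: "continuous_on {0..t} (\<lambda>s. \<Phi> s \<xi>)" by (rule \<Phi>_time_cont) auto
  obtain L where L: "L \<ge> 0" "\<And>s. s \<in> {0..t} \<Longrightarrow> norm (F' s (\<Phi> s \<xi>)) \<le> L"
    using F'_bounded_along[OF x] by blast
  obtain C \<delta>1 where C: "C > 0" "\<delta>1 > 0"
    "\<And>\<zeta> s. norm (\<zeta> - \<xi>) < \<delta>1 \<Longrightarrow> s \<in> {0..t} \<Longrightarrow> norm (\<Phi> s \<zeta> - \<Phi> s \<xi>) \<le> C * norm (\<zeta> - \<xi>)"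
    using locally_lipschitz[OF t] by metis
  \<comment> \<open>Chosen so that Gronwall's bound becomes exactly
    \<open>e * norm (\<zeta> - \<xi>)\<close>; \<open>t + 1\<close> in place of \<open>t\<close>
    keeps the denominator positive at time 0.\<close>
  define \<epsilon> where "\<epsilon> = e / (C * (t + 1) * exp (L * t))"
  have \<epsilon>: "\<epsilon> > 0" using e C t by (simp add: \<epsilon>_def)
  obtain \<delta>2 where \<delta>2: "\<delta>2 > 0" "\<And>s y. s \<in> {0..t} \<Longrightarrow> norm (y - \<Phi> s \<xi>) \<le> \<delta>2 \<Longrightarrow>
       norm (F s y - F s (\<Phi> s \<xi>) - F' s (\<Phi> s \<xi>) (y - \<Phi> s \<xi>)) \<le> norm (y - \<Phi> s \<xi>) * \<epsilon>"
    by (rule tube[OF x \<epsilon>]) auto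
  show "\<exists>d>0. \<forall>\<zeta>. norm (\<zeta> - \<xi>) < d \<longrightarrow>
      norm (\<Phi> t \<zeta> - \<Phi> t \<xi> - W t \<xi> (\<zeta> - \<xi>)) \<le> e * norm (\<zeta> - \<xi>)"
  proof (intro exI[of _ "min \<delta>1 (\<delta>2 / C)"] conjI allI impI)
    fix \<zeta> assume "norm (\<zeta> - \<xi>) < min \<delta>1 (\<delta>2 / C)"
    then have \<zeta>: "norm (\<zeta> - \<xi>) < \<delta>1" "C * norm (\<zeta> - \<xi>) < \<delta>2" using C by (auto simp: field_simps)
    define R where "R s = \<Phi> s \<zeta> - \<Phi> s \<xi> - W s \<xi> (\<zeta> - \<xi>)" for s
    have dR: "(R has_vector_derivative F s (\<Phi> s \<zeta>) - F s (\<Phi> s \<xi>)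
        - (F' s (\<Phi> s \<xi>) o\<^sub>L W s \<xi>) (\<zeta> - \<xi>)) (at s within {0..t})" if "s \<in> {0..t}" for s
      unfolding R_def
      by (intro has_vector_derivative_diff solves_ode_within \<Phi>_solves that
          bounded_linear.has_vector_derivative[OF blinfun.bounded_linear_left] W_solves)
    have bd: "norm (F s (\<Phi> s \<zeta>) - F s (\<Phi> s \<xi>) - (F' s (\<Phi> s \<xi>) o\<^sub>L W s \<xi>) (\<zeta> - \<xi>))
        \<le> L * norm (R s) + \<epsilon> * (C * norm (\<zeta> - \<xi>))" if s: "s \<in> {0..t}" for s
    proof -
      let ?u = "\<Phi> s \<zeta> - \<Phi> s \<xi>"
      have u: "norm ?u \<le> C * norm (\<zeta> - \<xi>)" by (rule C(3)[OF \<zeta>(1) s])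
      then have "norm (F s (\<Phi> s \<zeta>) - F s (\<Phi> s \<xi>) - F' s (\<Phi> s \<xi>) ?u) \<le> norm ?u * \<epsilon>"
        using \<zeta>(2) by (intro \<delta>2(2) s) auto
      also have "\<dots> \<le> C * norm (\<zeta> - \<xi>) * \<epsilon>" using u \<epsilon> by (intro mult_right_mono) auto
      finally have 1: "norm (F s (\<Phi> s \<zeta>) - F s (\<Phi> s \<xi>) - F' s (\<Phi> s \<xi>) ?u) \<le> \<epsilon> * (C * norm (\<zeta> - \<xi>))"
        by (simp add: mult.commute)
      have 2: "norm (F' s (\<Phi> s \<xi>) (R s)) \<le> L * norm (R s)"
        using L(2)[OF s] by (rule norm_blinfun_le)
      have "F s (\<Phi> s \<zeta>) - F s (\<Phi> s \<xi>) - (F' s (\<Phi> s \<xi>) o\<^sub>L W s \<xi>) (\<zeta> - \<xi>)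
        = (F s (\<Phi> s \<zeta>) - F s (\<Phi> s \<xi>) - F' s (\<Phi> s \<xi>) ?u) + F' s (\<Phi> s \<xi>) (R s)"
        by (simp add: R_def blinfun.diff_right)
      then show ?thesis using 1 2 norm_triangle_ineq by (smt (verit))
    qed
    have "norm (R t) \<le> (norm (R 0) + \<epsilon> * (C * norm (\<zeta> - \<xi>)) * t) * exp (L * t)"
      by (rule gronwall[OF dR bd]) (use L t \<epsilon> C in auto)
    also have "\<dots> \<le> \<epsilon> * (C * norm (\<zeta> - \<xi>)) * (t + 1) * exp (L * t)"
      using \<epsilon> C t by (auto simp: R_def \<Phi>_0 W_0 intro!: mult_right_mono mult_left_mono)
    also have "\<dots> = e * norm (\<zeta> - \<xi>)"
      using C t by (simp add: \<epsilon>_def)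
    finally show "norm (\<Phi> t \<zeta> - \<Phi> t \<xi> - W t \<xi> (\<zeta> - \<xi>)) \<le> e * norm (\<zeta> - \<xi>)" by (simp add: R_def)
  qed (use C \<delta>2 in auto)
qed (rule blinfun.bounded_linear_right)

text \<open>Variational equations along nearby trajectories have nearby coefficients, uniformly in
  time. Their solutions start equal, so Gronwall's inequality bounds the difference.\<close>

lemma W_cont: "continuous_on ({0..} \<times> UNIV) (\<lambda>(t, \<xi>). W t \<xi>)"
proof (rule continuous_on_time_stateI)
  fix T e :: real and \<xi> assume T: "T \<ge> 0" and e: "e > 0"
  have x: "continuous_on {0..T} (\<lambda>s. \<Phi> s \<xi>)" by (rule \<Phi>_time_cont) auto
  obtain L where L: "L \<ge> 0" "\<And>s. s \<in> {0..T} \<Longrightarrow> norm (F' s (\<Phi> s \<xi>)) \<le> L"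
    using F'_bounded_along[OF x] by blast
  have "compact ((\<lambda>s. W s \<xi>) ` {0..T})"
    by (intro compact_continuous_image W_time_cont) auto
  from compact_imp_bounded[OF this]
  obtain M where M: "M > 0" "\<And>s. s \<in> {0..T} \<Longrightarrow> norm (W s \<xi>) \<le> M"
    unfolding bounded_pos by auto
  define E where "E = M * (T + 1) * exp ((L + 1) * T)"
  have E: "E > 0" using M T by (simp add: E_def)
  \<comment> \<open>The cap 1 lets \<open>L + 1\<close> bound the coefficients along the perturbed
    trajectory; \<open>E\<close> is the factor by which Gronwall's estimate enlarges
    \<open>\<epsilon>\<close>.\<close>
  define \<epsilon> where "\<epsilon> = min 1 (e / E)"
  have \<epsilon>: "\<epsilon> > 0" "\<epsilon> \<le> 1" "\<epsilon> * E \<le> e" using e E by (auto simp: \<epsilon>_def min_def field_simps)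
  obtain \<delta>2 where \<delta>2: "\<delta>2 > 0"
    "\<And>s y. s \<in> {0..T} \<Longrightarrow> norm (y - \<Phi> s \<xi>) \<le> \<delta>2 \<Longrightarrow> norm (F' s y - F' s (\<Phi> s \<xi>)) \<le> \<epsilon>"
    by (rule tube[OF x \<epsilon>(1)]) auto
  obtain C \<delta>1 where C: "C > 0" "\<delta>1 > 0"
    "\<And>\<zeta> s. norm (\<zeta> - \<xi>) < \<delta>1 \<Longrightarrow> s \<in> {0..T} \<Longrightarrow> norm (\<Phi> s \<zeta> - \<Phi> s \<xi>) \<le> C * norm (\<zeta> - \<xi>)"
    using locally_lipschitz[OF T] by metis
  show "\<exists>\<delta>>0. \<forall>\<zeta>. norm (\<zeta> - \<xi>) < \<delta> \<longrightarrow> (\<forall>t\<in>{0..T}. norm (W t \<zeta> - W t \<xi>) \<le> e)"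
  proof (intro exI[of _ "min \<delta>1 (\<delta>2 / C)"] conjI allI impI ballI)
    fix \<zeta> t assume "norm (\<zeta> - \<xi>) < min \<delta>1 (\<delta>2 / C)" and t: "t \<in> {0..T}"
    then have \<zeta>: "norm (\<zeta> - \<xi>) < \<delta>1" "C * norm (\<zeta> - \<xi>) < \<delta>2" using C by (auto simp: field_simps)
    define D where "D s = W s \<zeta> - W s \<xi>" for s
    let ?B = "\<lambda>s. F' s (\<Phi> s \<zeta>)" and ?A = "\<lambda>s. F' s (\<Phi> s \<xi>)"
    have dD: "(D has_vector_derivative (?B s o\<^sub>L W s \<zeta>) - (?A s o\<^sub>L W s \<xi>)) (at s within {0..T})"
      if "s \<in> {0..T}" for s
      unfolding D_def by (intro has_vector_derivative_diff solves_ode_within[OF W_solves that])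
    have bd: "norm ((?B s o\<^sub>L W s \<zeta>) - (?A s o\<^sub>L W s \<xi>)) \<le> (L + 1) * norm (D s) + \<epsilon> * M"
      if s: "s \<in> {0..T}" for s
    proof -
      have 1: "norm (?B s - ?A s) \<le> \<epsilon>"
        using C(3)[OF \<zeta>(1) s] \<zeta>(2) by (intro \<delta>2(2) s) auto
      then have 2: "norm (?B s) \<le> L + 1"
        using L(2)[OF s] \<epsilon>(2) norm_triangle_sub[of "?B s" "?A s"] by linarith
      have "(?B s o\<^sub>L W s \<zeta>) - (?A s o\<^sub>L W s \<xi>) = (?B s o\<^sub>L D s) + ((?B s - ?A s) o\<^sub>L W s \<xi>)"
        unfolding D_def
        by (simp add: bounded_bilinear.diff_left[OF bounded_bilinear_blinfun_compose]
            bounded_bilinear.diff_right[OF bounded_bilinear_blinfun_compose])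
      also have "norm \<dots> \<le> norm (?B s) * norm (D s) + norm (?B s - ?A s) * norm (W s \<xi>)"
        by (intro norm_triangle_le add_mono norm_blinfun_compose)
      also have "\<dots> \<le> (L + 1) * norm (D s) + \<epsilon> * M"
        using 1 2 M(2)[OF s] \<epsilon> L(1) by (intro add_mono mult_mono) auto
      finally show ?thesis .
    qed
    have "norm (D t) \<le> (norm (D 0) + \<epsilon> * M * t) * exp ((L + 1) * t)"
      by (rule gronwall[OF dD bd]) (use L t \<epsilon> M in auto)
    also have "\<dots> \<le> (\<epsilon> * M * (T + 1)) * exp ((L + 1) * T)"
      using \<epsilon> M t L(1) by (intro mult_mono) (auto simp: D_def W_0)
    also have "\<dots> \<le> e" using \<epsilon>(3) by (simp add: E_def mult_ac)
    finally show "norm (W t \<zeta> - W t \<xi>) \<le> e" by (simp add: D_def)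
  qed (use C \<delta>2 in auto)
qed (rule W_time_cont, simp)

text \<open>Partial derivatives combine into a total derivative because the one in the state is
  jointly continuous; for the time direction the derivative at the point itself is enough.\<close>

lemma \<Phi>_joint_deriv:
  assumes "t \<ge> 0"
  shows "((\<lambda>(t, \<xi>). \<Phi> t \<xi>) has_derivative (\<lambda>(s, v). s *\<^sub>R F t (\<Phi> t \<xi>) + W t \<xi> v))
    (at (t, \<xi>) within {0..} \<times> UNIV)"
proof (rule has_derivative_partialsI)
  show "((\<lambda>t. \<Phi> t \<xi>) has_derivative (\<lambda>s. s *\<^sub>R F t (\<Phi> t \<xi>))) (at t within {0..})"
    using \<Phi>_solves assms unfolding solves_ode_def has_vector_derivative_def by blast
  show "((\<lambda>\<xi>. \<Phi> t \<xi>) has_derivative blinfun_apply (W t \<xi>)) (at \<xi> within UNIV)"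
    if "t \<in> {0..}" for t \<xi> using \<Phi>_deriv[of t \<xi>] that by simp
  show "continuous (at (t, \<xi>) within {0..} \<times> UNIV) (\<lambda>(t, \<xi>). W t \<xi>)"
    using W_cont assms by (simp add: continuous_on_eq_continuous_within)
qed auto

lemma C1_\<Phi>: "C1_on ({0..} \<times> UNIV) (\<lambda>(t, \<xi>). \<Phi> t \<xi>)"
proof (rule C1_onI[where h'="\<lambda>p v. fst v *\<^sub>R F (fst p) (\<Phi> (fst p) (snd p)) + W (fst p) (snd p) (snd v)"])
  show "((\<lambda>(t, \<xi>). \<Phi> t \<xi>) has_derivative
      (\<lambda>v. fst v *\<^sub>R F (fst p) (\<Phi> (fst p) (snd p)) + W (fst p) (snd p) (snd v)))
      (at p within {0..} \<times> UNIV)" if "p \<in> {0..} \<times> UNIV" for p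
    using that \<Phi>_joint_deriv[of "fst p" "snd p"] by (auto simp: case_prod_beta')
  have "continuous_on ({0..} \<times> UNIV) (\<lambda>p. \<Phi> (fst p) (snd p))"
    "continuous_on ({0..} \<times> UNIV) (\<lambda>p. W (fst p) (snd p))"
    using \<Phi>_cont W_cont by (simp_all add: case_prod_beta)
  then show "continuous_on ({0..} \<times> UNIV)
      (\<lambda>p. fst v *\<^sub>R F (fst p) (\<Phi> (fst p) (snd p)) + W (fst p) (snd p) (snd v))" for v
    by (intro continuous_intros F_along) auto
qed

end

section \<open>Second-order regularity of the flow\<close>

text \<open>The first variation \<open>w = W v\<close> solves \<open>w' = F' t (\<Phi> t \<xi>) w\<close>, so \<open>(\<Phi>, W v)\<close> is the
  flow of a vector field on the product space that is only \<open>C\<^sup>1\<close>, and \<open>C1_flow\<close> applies to it.\<close>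

locale C2_flow = C1_flow F F' \<Phi>
  for F :: "real \<Rightarrow> 'a::euclidean_space \<Rightarrow> 'a" and F' \<Phi> +
  fixes F'' :: "real \<Rightarrow> 'a \<Rightarrow> 'a \<Rightarrow>\<^sub>L ('a \<Rightarrow>\<^sub>L 'a)"
  assumes F'_deriv: "t \<ge> 0 \<Longrightarrow> (F' t has_derivative blinfun_apply (F'' t y)) (at y)"
    and F''_cont: "continuous_on ({0..} \<times> UNIV) (\<lambda>(t, y). F'' t y)"
begin

lemma C1_W: "C1_on ({0..} \<times> UNIV) (\<lambda>(t, \<xi>). W t \<xi> v)"
proof -
  define F2 where "F2 t z = (F t (fst z), F' t (fst z) (snd z))" for t and z :: "'a \<times> 'a"
  \<comment> \<open>The derivative of \<open>F2\<close>; the second component is the product rule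
    for \<open>F' t y w\<close>, with both \<open>y\<close> and \<open>w\<close> varying.\<close>
  define B where "B t z h = (F' t (fst z) (fst h), F' t (fst z) (snd h) + F'' t (fst z) (fst h) (snd z))"
    for t and z h :: "'a \<times> 'a"
  define \<Phi>2 where "\<Phi>2 t z = (\<Phi> t (fst z), W t (fst z) (snd z))" for t and z :: "'a \<times> 'a"
  have dF2: "(F2 t has_derivative B t z) (at z)" if t: "t \<ge> 0" for t z
  proof -
    have fst: "(fst has_derivative fst) (at z)" and snd: "(snd has_derivative snd) (at z)"
      by (auto intro!: derivative_eq_intros)
    have "((\<lambda>z. F t (fst z)) has_derivative (\<lambda>h. F' t (fst z) (fst h))) (at z)"
      using has_derivative_compose[OF fst F_deriv[OF t]] .
    moreover have "((\<lambda>z. F' t (fst z)) has_derivative (\<lambda>h. F'' t (fst z) (fst h))) (at z)"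
      using has_derivative_compose[OF fst F'_deriv[OF t]] .
    ultimately show ?thesis
      unfolding F2_def[abs_def] B_def[abs_def]
      by (intro has_derivative_Pair bounded_bilinear.FDERIV[OF bounded_bilinear_blinfun_apply] snd)
  qed
  have B: "blinfun_apply (Blinfun (B t z)) = B t z" if "t \<ge> 0" for t z
    using has_derivative_bounded_linear[OF dF2[OF that]] by (rule bounded_linear_Blinfun_apply)
  interpret ext: C1_flow F2 "\<lambda>t z. Blinfun (B t z)" \<Phi>2
  proof
    have F''_along: "continuous_on ({0..} \<times> UNIV) (\<lambda>p. F'' (fst p) (fst (snd p :: 'a \<times> 'a)))"
    proof -
      have "continuous_on ({0..} \<times> UNIV) (\<lambda>p. (fst p, fst (snd p :: 'a \<times> 'a)))"
        by (intro continuous_intros)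
      from continuous_on_compose2[OF F''_cont this] show ?thesis by (auto simp: image_subset_iff)
    qed
    show "continuous_on ({0..} \<times> UNIV) (\<lambda>(t, z). F2 t z)"
      unfolding F2_def case_prod_beta by (intro continuous_intros F_along F'_along) auto
    show "(F2 t has_derivative blinfun_apply (Blinfun (B t z))) (at z)" if "t \<ge> 0" for t z
      using dF2[OF that] by (simp add: B[OF that])
    show "continuous_on ({0..} \<times> UNIV) (\<lambda>(t, z). Blinfun (B t z))"
    proof (rule continuous_on_blinfun_componentwise)
      fix i :: "'a \<times> 'a"
      have "continuous_on ({0..} \<times> UNIV) (\<lambda>p. B (fst p) (snd p) i)"
        unfolding B_def by (intro continuous_intros F'_along F''_along) auto
      then show "continuous_on ({0..} \<times> UNIV) (\<lambda>p. (case p of (t, z) \<Rightarrow> Blinfun (B t z)) i)"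
        by (rule continuous_on_eq) (auto simp: B)
    qed
    show "\<Phi>2 0 z = z" for z by (simp add: \<Phi>2_def \<Phi>_0 W_0)
    show "solves_ode F2 (\<lambda>t. \<Phi>2 t z)" for z
      unfolding solves_ode_def
    proof (intro allI impI)
      fix t :: real assume t: "t \<ge> 0"
      have "((\<lambda>t. \<Phi> t (fst z)) has_vector_derivative F t (\<Phi> t (fst z))) (at t within {0..})"
        using \<Phi>_solves t unfolding solves_ode_def by blast
      moreover have "((\<lambda>t. W t (fst z)) has_vector_derivative F' t (\<Phi> t (fst z)) o\<^sub>L W t (fst z)) (at t within {0..})"
        using W_solves t unfolding solves_ode_def by blast
      then have "((\<lambda>t. W t (fst z) (snd z)) has_vector_derivative
          (F' t (\<Phi> t (fst z)) o\<^sub>L W t (fst z)) (snd z)) (at t within {0..})"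
        by (rule bounded_linear.has_vector_derivative[OF blinfun.bounded_linear_left])
      ultimately show "((\<lambda>t. \<Phi>2 t z) has_vector_derivative F2 t (\<Phi>2 t z)) (at t within {0..})"
        unfolding \<Phi>2_def F2_def by (auto intro: has_vector_derivative_Pair)
    qed
  qed
  \<comment> \<open>Freezing the second initial value at \<open>v\<close> and projecting the
    extended flow to its second component recovers \<open>W t \<xi> v\<close>.\<close>
  have "C1_on ({0..} \<times> UNIV) (\<lambda>p :: real \<times> 'a. (fst p, snd p, v))"
    by (intro C1_on_Pair C1_on_const C1_on_bounded_linear bounded_linear_fst bounded_linear_snd)
  from C1_on_linear_compose[OF bounded_linear_snd C1_on_compose[OF this ext.C1_\<Phi>]]
  have "C1_on ({0..} \<times> UNIV) (\<lambda>p. W (fst p) (snd p) v)"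
    by (auto simp: \<Phi>2_def case_prod_beta image_subset_iff)
  then show ?thesis by (simp add: case_prod_beta')
qed

end

section \<open>Matrix form of the derivatives and Liouville's formula\<close>

lemma bounded_bilinear_matrix_vector_mult:
  "bounded_bilinear ((*v) :: real^'n^'m \<Rightarrow> real^'n \<Rightarrow> real^'m)"
  unfolding bilinear_conv_bounded_bilinear[symmetric] bilinear_def
  by (auto intro!: linearI simp: matrix_vector_right_distrib matrix_vector_mult_add_rdistrib
      scaleR_matrix_vector_assoc matrix_vector_mult_scaleR)

lemma bounded_bilinear_matrix_matrix_mult:
  "bounded_bilinear ((**) :: real^'n^'m \<Rightarrow> real^'k^'n \<Rightarrow> real^'k^'m)"
  unfolding bilinear_conv_bounded_bilinear[symmetric] bilinear_def
  by (auto intro!: linearI simp: vec_eq_iff matrix_matrix_mult_def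
      sum_distrib_left sum.distrib algebra_simps)

lemma has_derivative_compose_into:
  assumes f: "(f has_derivative f') (at x within S)"
    and g: "(g has_derivative g') (at (f x) within T)" and "f ` S \<subseteq> T"
  shows "((\<lambda>x. g (f x)) has_derivative (\<lambda>v. g' (f' v))) (at x within S)"
  by (rule has_derivative_in_compose[OF f has_derivative_subset[OF g assms(3)]])

lemma bounded_linear_matrix_blinfun:
  "bounded_linear (\<lambda>V::(real^'n) \<Rightarrow>\<^sub>L (real^'m). matrix (blinfun_apply V))"
proof -
  have eq: "matrix (blinfun_apply V)
      = (\<Sum>i\<in>UNIV. \<Sum>j\<in>UNIV. (V (axis j 1) $ i) *\<^sub>R axis i (axis j 1))"
    for V :: "(real^'n) \<Rightarrow>\<^sub>L (real^'m)"
  proof -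
    have "(axis i (axis j 1) :: real^'n^'m) $ a $ b = (if b = j then if a = i then 1 else 0 else 0)"
      for i j a b by (simp add: axis_def)
    then show ?thesis
      by (simp add: vec_eq_iff matrix_def if_distrib[of "\<lambda>x. _ * x"] cong: if_cong)
  qed
  show ?thesis
    unfolding eq
    by (intro bounded_linear_sum bounded_linear_compose[OF bounded_linear_scaleR_left]
        bounded_linear_compose[OF bounded_linear_vec_nth] blinfun.bounded_linear_left)
qed

lemma linear_trace: "linear (trace :: real^'n^'n \<Rightarrow> real)"
  by (rule linearI) (simp_all add: trace_def sum.distrib sum_distrib_left)

text \<open>By the derivative of the determinant, \<open>det (M t)\<close> divided by the claimed
  exponential has derivative 0, and it equals 1 at time 0.\<close>

lemma liouville:
  fixes M B :: "real \<Rightarrow> real^'n^'n"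
  assumes M: "\<And>t. t \<ge> 0 \<Longrightarrow> (M has_vector_derivative B t ** M t) (at t within {0..})"
    and M0: "M 0 = mat 1" and B: "continuous_on {0..} B" and t: "t \<ge> 0"
  shows "det (M t) = exp (integral {0..t} (\<lambda>s. trace (B s)))"
proof -
  define I where "I t = integral {0..t} (\<lambda>s. trace (B s))" for t
  have contB: "continuous_on {0..} (\<lambda>s. trace (B s))"
    by (rule linear_continuous_on_compose[OF B linear_trace])
  have dI: "(I has_real_derivative trace (B t)) (at t within {0..})" if "t \<ge> 0" for t
    using has_vector_derivative_integral_atLeast[OF contB that]
    unfolding I_def has_real_derivative_iff_has_vector_derivative .
  have "((\<lambda>t. det (M t) * exp (- I t)) has_vector_derivative 0) (at t within {0..})"
    if t: "t \<in> {0..}" for t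
  proof -
    have "((\<lambda>t. det (M t)) has_real_derivative trace (B t) * det (M t)) (at t within {0..})"
      using has_real_derivative_det[OF M] t by simp
    then have "((\<lambda>t. det (M t) * exp (- I t)) has_real_derivative 0) (at t within {0..})"
      using dI[of t] t by (auto intro!: derivative_eq_intros)
    then show ?thesis by (simp add: has_real_derivative_iff_has_vector_derivative)
  qed
  from has_vector_derivative_zero_constant[OF convex_real_interval(1) this]
  obtain c where c: "\<And>t. t \<ge> 0 \<Longrightarrow> det (M t) * exp (- I t) = c" by (metis atLeast_iff)
  have "c = 1" using c[of 0] by (simp add: I_def M0)
  with c[OF t] show ?thesis by (simp add: exp_minus I_def field_simps)
qed

section \<open>Densities transported by a flow\<close>

lemma gradient_inner:
  assumes "(h has_derivative h') (at z)"
  shows "gradient h z \<bullet> v = h' v"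
proof -
  interpret bounded_linear h' using assms by (rule has_derivative_bounded_linear)
  have "gradient h z \<bullet> v = (\<Sum>i\<in>UNIV. v $ i * h' (axis i 1))"
    by (simp add: gradient_def inner_vec_def frechet_derivative_at[OF assms, symmetric] mult.commute)
  also have "\<dots> = h' (\<Sum>i\<in>UNIV. v $ i *\<^sub>R axis i 1)"
    by (simp add: sum scaleR)
  also have "(\<Sum>i\<in>UNIV. v $ i *\<^sub>R axis i 1) = v"
    by (simp add: vec_eq_iff axis_def if_distrib cong: if_cong)
  finally show ?thesis .
qed

lemma divergence_eq_trace: "(h has_derivative h') (at z) \<Longrightarrow> divergence h z = trace (matrix h')"
  by (simp add: divergence_def jacobian_def frechet_derivative_at[symmetric])

lemma jacobian_eq:
  fixes h :: "real^'n \<Rightarrow> real^'n"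
  assumes "(h has_derivative (*v) H) (at z)"
  shows "jacobian h (at z) = H"
  by (simp add: jacobian_def frechet_derivative_at[OF assms, symmetric])

text \<open>Properness is required uniformly on compact time intervals because it serves twice: for
  surjectivity at a fixed time, and for joint continuity of the inverse flow in time and
  state.\<close>

locale proper_C2_flow = C2_flow F F' \<Phi> F''
  for F :: "real \<Rightarrow> real^'n \<Rightarrow> real^'n" and F' \<Phi> F'' +
  assumes proper: "T \<ge> 0 \<Longrightarrow> \<exists>R. \<forall>t\<in>{0..T}. \<forall>\<xi>. norm (\<Phi> t \<xi>) \<le> r \<longrightarrow> norm \<xi> \<le> R"
begin

lemma inj_\<Phi>: "t \<ge> 0 \<Longrightarrow> inj (\<Phi> t)"
  using unique[OF \<Phi>_solves \<Phi>_solves, where \<tau> = t and t = 0] by (auto simp: inj_def \<Phi>_0)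

lemma \<Phi>_state_cont: "t \<ge> 0 \<Longrightarrow> continuous_on S (\<Phi> t)"
  using \<Phi>_deriv by (meson has_derivative_continuous_on has_derivative_at_withinI)

text \<open>The range of the proper local homeomorphism \<open>\<Phi> t\<close> is both open and closed.\<close>

lemma surj_\<Phi>:
  assumes t: "t \<ge> 0"
  shows "surj (\<Phi> t)"
proof -
  have "open (range (\<Phi> t))"
    by (rule invariance_of_domain[OF \<Phi>_state_cont[OF t] open_UNIV inj_\<Phi>[OF t]])
  moreover have "closed (range (\<Phi> t))"
    unfolding closure_subset_eq[symmetric]
  proof
    fix \<eta> assume \<eta>: "\<eta> \<in> closure (range (\<Phi> t))"
    obtain R where "\<forall>s\<in>{0..t}. \<forall>\<xi>. norm (\<Phi> s \<xi>) \<le> norm \<eta> + 1 \<longrightarrow> norm \<xi> \<le> R"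
      using proper[OF t, of "norm \<eta> + 1"] ..
    then have R: "norm \<xi> \<le> R" if "norm (\<Phi> t \<xi>) \<le> norm \<eta> + 1" for \<xi>
      using that t by auto
    have "closed (\<Phi> t ` cball 0 R)"
      by (intro compact_imp_closed compact_continuous_image \<Phi>_state_cont t) auto
    moreover have "\<eta> \<in> closure (\<Phi> t ` cball 0 R)"
      unfolding closure_approachable
    proof (intro allI impI)
      fix e :: real assume "e > 0"
      then have "min e 1 > 0" by simp
      with \<eta> obtain \<xi> where \<xi>: "dist (\<Phi> t \<xi>) \<eta> < min e 1"
        unfolding closure_approachable by fast
      then have "norm (\<Phi> t \<xi>) \<le> norm \<eta> + 1"
        using norm_triangle_sub[of "\<Phi> t \<xi>" \<eta>] by (simp add: dist_norm)
      then have "\<xi> \<in> cball 0 R" using R by simp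
      with \<xi> show "\<exists>y\<in>\<Phi> t ` cball 0 R. dist y \<eta> < e" by auto
    qed
    ultimately show "\<eta> \<in> range (\<Phi> t)" by auto
  qed
  ultimately have "range (\<Phi> t) = {} \<or> range (\<Phi> t) = UNIV" by (simp only: clopen[symmetric])
  then show ?thesis by simp
qed

section \<open>The inverse flow and its regularity\<close>

definition \<Psi> :: "real \<Rightarrow> real^'n \<Rightarrow> real^'n" where "\<Psi> t = inv (\<Phi> t)"

lemma \<Phi>_\<Psi> [simp]: "t \<ge> 0 \<Longrightarrow> \<Phi> t (\<Psi> t \<eta>) = \<eta>"
  by (simp add: \<Psi>_def surj_f_inv_f surj_\<Phi>)

lemma \<Psi>_\<Phi> [simp]: "t \<ge> 0 \<Longrightarrow> \<Psi> t (\<Phi> t \<xi>) = \<xi>"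
  by (simp add: \<Psi>_def inv_f_f inj_\<Phi>)

text \<open>The trajectory through \<open>\<eta>\<close> at time \<open>\<tau>\<close> is the one
  that starts at \<open>\<Psi> \<tau> \<eta>\<close>; uniqueness in both time directions makes the
  definite description denote its value.\<close>

lemma ode_solution_eq:
  assumes "\<tau> \<ge> 0" "t \<ge> 0"
  shows "ode_solution F t \<tau> \<eta> = \<Phi> t (\<Psi> \<tau> \<eta>)"
  unfolding ode_solution_def
proof (rule the_equality)
  show "\<exists>\<phi>. solves_ode F \<phi> \<and> \<phi> \<tau> = \<eta> \<and> \<phi> t = \<Phi> t (\<Psi> \<tau> \<eta>)"
    using assms by (intro exI[of _ "\<lambda>t. \<Phi> t (\<Psi> \<tau> \<eta>)"]) (simp add: \<Phi>_solves)
  show "v = \<Phi> t (\<Psi> \<tau> \<eta>)" if "\<exists>\<phi>. solves_ode F \<phi> \<and> \<phi> \<tau> = \<eta> \<and> \<phi> t = v" for v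
    using that unique[OF _ \<Phi>_solves[of "\<Psi> \<tau> \<eta>"], where \<tau> = \<tau> and t = t] assms by auto
qed

definition M :: "real \<Rightarrow> real^'n \<Rightarrow> real^'n^'n" where "M t \<xi> = matrix (W t \<xi>)"

lemma M_mult: "M t \<xi> *v v = W t \<xi> v"
  by (simp add: M_def matrix_works blinfun.bounded_linear_right bounded_linear.linear)

lemma \<Phi>_deriv_M: "t \<ge> 0 \<Longrightarrow> (\<Phi> t has_derivative (*v) (M t \<xi>)) (at \<xi>)"
  using \<Phi>_deriv[of t \<xi>] by (simp add: M_mult[abs_def] fun_eq_iff)

lemma C1_M: "C1_on ({0..} \<times> UNIV) (\<lambda>(t, \<xi>). M t \<xi>)"
proof -
  have "C1_on ({0..} \<times> UNIV) (\<lambda>p. M (fst p) (snd p))"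
  proof (rule C1_on_vec, rule C1_on_vec)
    show "C1_on ({0..} \<times> UNIV) (\<lambda>p. M (fst p) (snd p) $ i $ j)" for i j
      using C1_on_component[OF C1_W, of "axis j 1" i]
      by (simp add: M_def matrix_def case_prod_beta')
  qed
  then show ?thesis by (simp add: case_prod_beta')
qed

text \<open>Liouville's formula for the variational equation. Besides positivity, the explicit
  exponential later gives the bound on the inverse determinant needed for integrability.\<close>

lemma det_M:
  assumes "t \<ge> 0"
  shows "det (M t \<xi>) = exp (integral {0..t} (\<lambda>s. trace (matrix (F' s (\<Phi> s \<xi>)))))"
proof (rule liouville[OF _ _ _ assms])
  show "((\<lambda>t. M t \<xi>) has_vector_derivative matrix (F' t (\<Phi> t \<xi>)) ** M t \<xi>) (at t within {0..})"
    if "t \<ge> 0" for t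
  proof -
    have "((\<lambda>t. W t \<xi>) has_vector_derivative F' t (\<Phi> t \<xi>) o\<^sub>L W t \<xi>) (at t within {0..})"
      using W_solves that unfolding solves_ode_def by blast
    from bounded_linear.has_vector_derivative[OF bounded_linear_matrix_blinfun this]
    show ?thesis
      by (simp add: M_def blinfun_compose.rep_eq matrix_compose[unfolded o_def] o_def
          blinfun.bounded_linear_right bounded_linear.linear)
  qed
  show "M 0 \<xi> = mat 1" by (simp add: M_def W_0 id_def[symmetric] matrix_id_mat_1)
  show "continuous_on {0..} (\<lambda>t. matrix (F' t (\<Phi> t \<xi>)))"
    by (intro bounded_linear.continuous_on[OF bounded_linear_matrix_blinfun] F'_along
        \<Phi>_time_cont continuous_intros) auto
qed

lemma det_M_pos: "t \<ge> 0 \<Longrightarrow> det (M t \<xi>) > 0"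
  by (simp add: det_M)

lemma M_invertible: "t \<ge> 0 \<Longrightarrow> invertible (M t \<xi>)"
  using det_M_pos[of t \<xi>] by (simp add: invertible_det_nz)

lemma det_M_deriv:
  assumes "t \<ge> 0"
  shows "((\<lambda>t. det (M t \<xi>)) has_real_derivative trace (matrix (F' t (\<Phi> t \<xi>))) * det (M t \<xi>)) (at t within {0..})"
proof -
  have "continuous_on {0..} (\<lambda>s. trace (matrix (F' s (\<Phi> s \<xi>))))"
    by (intro linear_continuous_on_compose[OF _ linear_trace]
        bounded_linear.continuous_on[OF bounded_linear_matrix_blinfun] F'_along
        \<Phi>_time_cont continuous_intros) auto
  from has_vector_derivative_integral_atLeast[OF this assms]
  have "((\<lambda>t. exp (integral {0..t} (\<lambda>s. trace (matrix (F' s (\<Phi> s \<xi>)))))) has_real_derivative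
      trace (matrix (F' t (\<Phi> t \<xi>))) * det (M t \<xi>)) (at t within {0..})"
    unfolding det_M[OF assms] has_real_derivative_iff_has_vector_derivative[symmetric]
    by (auto intro!: derivative_eq_intros)
  then show ?thesis
    by (rule has_field_derivative_transform_within[where d=1]) (auto simp: det_M assms)
qed

text \<open>On a compact set the continuous injection \<open>\<Theta>\<close> has a continuous
  inverse. Properness makes the image of a large enough \<open>K\<close> contain a relative
  neighbourhood of the given point, including points with time 0.\<close>

lemma \<Psi>_cont: "continuous_on ({0..} \<times> UNIV) (\<lambda>p. \<Psi> (fst p) (snd p))"
  unfolding continuous_on_eq_continuous_within
proof
  fix p :: "real \<times> (real^'n)" assume p: "p \<in> {0..} \<times> UNIV"
  \<comment> \<open>The margins 1 in time and in norm place \<open>p\<close> in the interior of the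
    region \<open>U\<close> on which properness is used.\<close>
  define T where "T = fst p + 1"
  define r where "r = norm (snd p) + 1"
  have T: "T \<ge> 0" using p by (auto simp: T_def)
  obtain R where R: "\<And>t \<xi>. t \<in> {0..T} \<Longrightarrow> norm (\<Phi> t \<xi>) \<le> r \<Longrightarrow> norm \<xi> \<le> R"
    using proper[OF T, of r] by blast
  define K where "K = {0..T} \<times> cball (0::real^'n) R"
  define \<Theta> where "\<Theta> q = (fst q, \<Phi> (fst q) (snd q))" for q :: "real \<times> (real^'n)"
  have "K \<subseteq> {0..} \<times> UNIV" by (auto simp: K_def)
  from continuous_on_subset[OF \<Phi>_cont this] have "continuous_on K \<Theta>"
    unfolding \<Theta>_def by (intro continuous_intros) (simp add: case_prod_beta')
  moreover have "compact K" by (simp add: K_def compact_Times)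
  ultimately have "continuous_on (\<Theta> ` K) (\<lambda>q. (fst q, \<Psi> (fst q) (snd q)))"
    by (rule continuous_on_inv) (auto simp: \<Theta>_def K_def)
  then have cont: "continuous_on (\<Theta> ` K) (\<lambda>q. \<Psi> (fst q) (snd q))"
    using continuous_on_snd by fastforce
  define U where "U = {..<T} \<times> ball (0::real^'n) r"
  have sub: "({0..} \<times> UNIV) \<inter> U \<subseteq> \<Theta> ` K"
  proof
    fix q assume q: "q \<in> ({0..} \<times> UNIV) \<inter> U"
    then have "norm (\<Psi> (fst q) (snd q)) \<le> R"
      by (intro R[of "fst q"]) (auto simp: U_def)
    with q show "q \<in> \<Theta> ` K"
      by (intro image_eqI[of _ _ "(fst q, \<Psi> (fst q) (snd q))"]) (auto simp: \<Theta>_def K_def U_def)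
  qed
  have "p \<in> U" by (auto simp: U_def T_def r_def mem_Times_iff)
  moreover have "open U" by (simp add: U_def open_Times)
  ultimately have "at p within ({0..} \<times> UNIV) \<inter> U = at p within {0..} \<times> UNIV"
    by (intro at_within_nhd[of _ U]) auto
  moreover have "continuous (at p within ({0..} \<times> UNIV) \<inter> U) (\<lambda>q. \<Psi> (fst q) (snd q))"
    using continuous_on_subset[OF cont sub] p \<open>p \<in> U\<close> by (simp add: continuous_on_eq_continuous_within)
  ultimately show "continuous (at p within {0..} \<times> UNIV) (\<lambda>q. \<Psi> (fst q) (snd q))" by simp
qed

text \<open>Time is carried along as a component so that the map becomes the inverse of
  \<open>\<Theta>\<close> on the half-space. An inverse already known to be continuous is
  differentiable wherever the derivative of \<open>\<Theta>\<close> has a linear left inverse, also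
  at the boundary.\<close>

lemma \<Psi>_joint_deriv:
  assumes t: "t \<ge> 0"
  shows "((\<lambda>p. (fst p, \<Psi> (fst p) (snd p))) has_derivative
    (\<lambda>v. (fst v, matrix_inv (M t (\<Psi> t \<eta>)) *v (snd v - fst v *\<^sub>R F t \<eta>)))) (at (t, \<eta>) within {0..} \<times> UNIV)"
proof -
  define \<Theta> where "\<Theta> q = (fst q, \<Phi> (fst q) (snd q))" for q :: "real \<times> (real^'n)"
  let ?S = "{0::real..} \<times> (UNIV :: (real^'n) set)" and ?a = "(t, \<Psi> t \<eta>)"
  let ?N = "matrix_inv (M t (\<Psi> t \<eta>))"
  \<comment> \<open>The inverse is differentiated within the image of \<open>\<Theta>\<close>; since
    every time slice is onto, that image is again the whole half-space.\<close>
  have img: "\<Theta> ` ?S = ?S"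
  proof
    show "?S \<subseteq> \<Theta> ` ?S"
    proof
      fix q assume q: "q \<in> ?S"
      then show "q \<in> \<Theta> ` ?S"
        by (intro image_eqI[of _ _ "(fst q, \<Psi> (fst q) (snd q))"]) (auto simp: \<Theta>_def)
    qed
  qed (auto simp: \<Theta>_def)
  have "((\<lambda>q. \<Phi> (fst q) (snd q)) has_derivative (\<lambda>v. fst v *\<^sub>R F t \<eta> + W t (\<Psi> t \<eta>) (snd v))) (at ?a within ?S)"
    using \<Phi>_joint_deriv[OF t, of "\<Psi> t \<eta>"] t by (simp add: case_prod_beta')
  then have "(\<Theta> has_derivative (\<lambda>v. (fst v, fst v *\<^sub>R F t \<eta> + W t (\<Psi> t \<eta>) (snd v)))) (at ?a within ?S)"
    unfolding \<Theta>_def by (auto intro!: derivative_eq_intros)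
  moreover have "continuous (at (\<Theta> ?a) within \<Theta> ` ?S) (\<lambda>p. (fst p, \<Psi> (fst p) (snd p)))"
    using \<Psi>_cont t unfolding img
    by (intro continuous_intros) (auto simp: \<Theta>_def continuous_on_eq_continuous_within)
  moreover have "?a \<in> ?S" using t by simp
  moreover have "linear (\<lambda>v. (fst v, ?N *v (snd v - fst v *\<^sub>R F t \<eta>)))"
    by (rule linearI) (auto simp: algebra_simps matrix_vector_mult_scaleR
        matrix_vector_mult_diff_distrib matrix_vector_right_distrib)
  moreover have "(\<lambda>v. (fst v, ?N *v (snd v - fst v *\<^sub>R F t \<eta>)))
      \<circ> (\<lambda>v. (fst v, fst v *\<^sub>R F t \<eta> + W t (\<Psi> t \<eta>) (snd v))) = id"
    by (auto simp: fun_eq_iff M_mult[symmetric] matrix_vector_mul_assoc matrix_inv_left M_invertible t)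
  ultimately have "((\<lambda>p. (fst p, \<Psi> (fst p) (snd p))) has_derivative
    (\<lambda>v. (fst v, ?N *v (snd v - fst v *\<^sub>R F t \<eta>)))) (at (\<Theta> ?a) within \<Theta> ` ?S)"
    by (rule has_derivative_inverse_within) (auto simp: \<Theta>_def)
  then show ?thesis unfolding img by (simp add: \<Theta>_def t)
qed

lemma C1_\<Psi>: "C1_on ({0..} \<times> UNIV) (\<lambda>p. (fst p, \<Psi> (fst p) (snd p)))"
proof (rule C1_onI[where h'="\<lambda>p v. (fst v, matrix_inv (M (fst p) (\<Psi> (fst p) (snd p))) *v
      (snd v - fst v *\<^sub>R F (fst p) (snd p)))"])
  show "((\<lambda>p. (fst p, \<Psi> (fst p) (snd p))) has_derivative
    (\<lambda>v. (fst v, matrix_inv (M (fst p) (\<Psi> (fst p) (snd p))) *v (snd v - fst v *\<^sub>R F (fst p) (snd p)))))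
    (at p within {0..} \<times> UNIV)" if "p \<in> {0..} \<times> UNIV" for p
    using \<Psi>_joint_deriv[of "fst p" "snd p"] that by auto
  have "C1_on ({0..} \<times> UNIV) (\<lambda>p. matrix_inv (M (fst p) (snd p)))"
    using C1_M by (intro C1_on_matrix_inv) (auto simp: case_prod_beta' M_invertible)
  then have "continuous_on ({0..} \<times> UNIV) (\<lambda>p. matrix_inv (M (fst p) (snd p)))"
    by (rule C1_on_imp_continuous_on)
  moreover have "continuous_on ({0..} \<times> UNIV) (\<lambda>p. (fst p, \<Psi> (fst p) (snd p)))"
    by (intro continuous_intros \<Psi>_cont)
  ultimately have "continuous_on ({0..} \<times> UNIV) ((\<lambda>p. matrix_inv (M (fst p) (snd p))) \<circ> (\<lambda>p. (fst p, \<Psi> (fst p) (snd p))))"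
    by (intro continuous_on_compose) (auto intro: continuous_on_subset)
  then have "continuous_on ({0..} \<times> UNIV) (\<lambda>p. matrix_inv (M (fst p) (\<Psi> (fst p) (snd p))))"
    by (simp add: o_def)
  then show "continuous_on ({0..} \<times> UNIV) (\<lambda>p. (fst v, matrix_inv (M (fst p) (\<Psi> (fst p) (snd p))) *v
      (snd v - fst v *\<^sub>R F (fst p) (snd p))))" for v
    by (intro continuous_intros F_along
        bounded_bilinear.continuous_on[OF bounded_bilinear_matrix_vector_mult]) auto
qed

lemma \<Psi>_deriv:
  assumes t: "t \<ge> 0"
  shows "(\<Psi> t has_derivative (*v) (matrix_inv (M t (\<Psi> t \<eta>)))) (at \<eta>)"
proof -
  have "((\<lambda>\<eta>. (t, \<eta>)) has_derivative (\<lambda>v. (0, v))) (at \<eta>)"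
    by (auto intro!: derivative_eq_intros)
  from has_derivative_compose_into[OF this \<Psi>_joint_deriv[OF t]] t
  have "((\<lambda>\<eta>. (t, \<Psi> t \<eta>)) has_derivative (\<lambda>v. (0, matrix_inv (M t (\<Psi> t \<eta>)) *v v))) (at \<eta>)"
    by (auto simp: image_subset_iff)
  from has_derivative_snd[OF this] show ?thesis by simp
qed

lemma C1_state:
  fixes h :: "real \<Rightarrow> real^'n \<Rightarrow> 'b::real_normed_vector"
  assumes t: "t \<ge> 0" and h: "C1_on ({0..} \<times> UNIV) (\<lambda>p. h (fst p) (snd p))"
  shows "C1_on UNIV (h t)"
proof -
  have "C1_on UNIV (\<lambda>\<xi>::real^'n. (t, \<xi>))"
    by (rule C1_on_Pair[OF C1_on_const C1_on_bounded_linear[OF bounded_linear_ident]])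
  from C1_on_compose[OF this h] t show ?thesis by (auto simp: image_subset_iff)
qed

lemma C1_M_\<Psi>: "C1_on ({0..} \<times> UNIV) (\<lambda>p. M (fst p) (\<Psi> (fst p) (snd p)))"
  using C1_on_compose[OF C1_\<Psi> C1_M] by (auto simp: image_subset_iff case_prod_beta')

lemma C1_matrix_inv_M_\<Psi>: "t \<ge> 0 \<Longrightarrow> C1_on UNIV (\<lambda>\<eta>. matrix_inv (M t (\<Psi> t \<eta>)))"
  by (intro C1_on_matrix_inv C1_state[of t "\<lambda>t \<eta>. M t (\<Psi> t \<eta>)"] C1_M_\<Psi> M_invertible)

section \<open>The transported Gaussian as a density function\<close>

text \<open>The factor \<open>1 + t\<close> makes the continuity expression strictly positive rather than zero.\<close>

definition transported :: "real \<Rightarrow> real^'n \<Rightarrow> real" where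
  "transported t \<eta> = (1 + t) * exp (- (\<Psi> t \<eta> \<bullet> \<Psi> t \<eta>)) * inverse (det (M t (\<Psi> t \<eta>)))"

lemma transported_nonneg: "t \<ge> 0 \<Longrightarrow> transported t \<eta> \<ge> 0"
  using det_M_pos[of t "\<Psi> t \<eta>"] by (simp add: transported_def)

lemma C1_transported: "C1_on ({0..} \<times> UNIV) (\<lambda>p. transported (fst p) (snd p))"
proof -
  have \<Psi>: "C1_on ({0..} \<times> UNIV) (\<lambda>p. \<Psi> (fst p) (snd p))"
    using C1_on_linear_compose[OF bounded_linear_snd C1_\<Psi>] by simp
  have "C1_on ({0..} \<times> UNIV) (\<lambda>p. - (\<Psi> (fst p) (snd p) \<bullet> \<Psi> (fst p) (snd p)))"
    by (rule C1_on_linear_compose[OF bounded_linear_minus[OF bounded_linear_ident] C1_on_inner_self[OF \<Psi>]])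
  moreover have "det (M (fst p) (\<Psi> (fst p) (snd p))) \<noteq> 0" if "p \<in> {0..} \<times> UNIV" for p
    using det_M_pos[of "fst p" "\<Psi> (fst p) (snd p)"] that by auto
  ultimately show ?thesis
    unfolding transported_def
    by (intro C1_on_mult C1_on_exp C1_on_inverse C1_on_det C1_M_\<Psi> C1_on_add C1_on_const
        C1_on_bounded_linear[OF bounded_linear_fst])
qed

lemma transported_continuity_equation:
  assumes t: "t \<ge> 0"
  shows "vector_derivative (\<lambda>s. transported s \<eta>) (at t within {0..})
    + (gradient (transported t) \<eta> \<bullet> F t \<eta> + transported t \<eta> * divergence (F t) \<eta>) > 0"
proof -
  let ?S = "{0::real..} \<times> (UNIV :: (real^'n) set)"
  obtain D where D: "((\<lambda>p. transported (fst p) (snd p)) has_derivative blinfun_apply D) (at (t, \<eta>) within ?S)"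
    using C1_transported t unfolding C1_on_def by auto
  \<comment> \<open>One-sided derivatives are unique because \<open>t\<close> is a limit point of
    the half-line; this identifies the \<open>vector_derivative\<close> and later allows
    \<open>d1\<close> and \<open>d2\<close> to be equated.\<close>
  have nb: "at t within {0..} \<noteq> bot"
  proof -
    have "t islimpt {t..t + 1}" by (rule connected_imp_perfect) auto
    then have "t islimpt {0..}" by (rule islimpt_subset) (use t in auto)
    then show ?thesis by (simp add: trivial_limit_within)
  qed
  define \<xi> where "\<xi> = \<Psi> t \<eta>"
  have \<xi>: "\<Phi> t \<xi> = \<eta>" using t by (simp add: \<xi>_def)
  have "((\<lambda>s. (s, \<eta>)) has_derivative (\<lambda>h. (h, 0))) (at t within {0..})"
    by (auto intro!: derivative_eq_intros)
  from has_derivative_compose_into[OF this D] t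
  have "((\<lambda>s. transported s \<eta>) has_derivative (\<lambda>h. D (h, 0))) (at t within {0..})"
    by (auto simp: image_subset_iff)
  also have "(\<lambda>h. D (h, 0)) = (\<lambda>h. h *\<^sub>R D (1, 0))"
  proof
    show "D (h, 0) = h *\<^sub>R D (1, 0)" for h
      using blinfun.scaleR_right[of D h "(1, 0)"] by simp
  qed
  finally have "((\<lambda>s. transported s \<eta>) has_vector_derivative D (1, 0)) (at t within {0..})"
    by (simp only: has_vector_derivative_def)
  then have 1: "vector_derivative (\<lambda>s. transported s \<eta>) (at t within {0..}) = D (1, 0)"
    by (rule vector_derivative_within[OF nb])
  have "((\<lambda>z. (t, z)) has_derivative (\<lambda>h. (0, h))) (at \<eta>)"
    by (auto intro!: derivative_eq_intros)
  from has_derivative_compose_into[OF this D] t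
  have "(transported t has_derivative (\<lambda>h. D (0, h))) (at \<eta>)"
    by (auto simp: image_subset_iff)
  then have 2: "gradient (transported t) \<eta> \<bullet> F t \<eta> = D (0, F t \<eta>)"
    by (rule gradient_inner)
  define \<delta> where "\<delta> = trace (matrix (F' t \<eta>))"
  have 3: "divergence (F t) \<eta> = \<delta>"
    unfolding \<delta>_def by (intro divergence_eq_trace F_deriv t)
  have "((\<lambda>s. \<Phi> s \<xi>) has_vector_derivative F t \<eta>) (at t within {0..})"
    using \<Phi>_solves[of \<xi>] t \<xi> unfolding solves_ode_def by auto
  then have "((\<lambda>s. (s, \<Phi> s \<xi>)) has_derivative (\<lambda>h. (h, h *\<^sub>R F t \<eta>))) (at t within {0..})"
    unfolding has_vector_derivative_def by (auto intro!: derivative_eq_intros)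
  from has_derivative_compose_into[OF this, of "\<lambda>p. transported (fst p) (snd p)" D ?S] D t
  have "((\<lambda>s. transported s (\<Phi> s \<xi>)) has_derivative (\<lambda>h. D (h, h *\<^sub>R F t \<eta>))) (at t within {0..})"
    by (auto simp: image_subset_iff \<xi>)
  also have "(\<lambda>h. D (h, h *\<^sub>R F t \<eta>)) = (*) (D (1, 0) + D (0, F t \<eta>))"
  proof
    show "D (h, h *\<^sub>R F t \<eta>) = (D (1, 0) + D (0, F t \<eta>)) * h" for h
      using blinfun.scaleR_right[of D h "(1, F t \<eta>)"] blinfun.add_right[of D "(1, 0)" "(0, F t \<eta>)"]
      by (simp add: mult.commute)
  qed
  finally have "((\<lambda>s. transported s (\<Phi> s \<xi>)) has_real_derivative D (1, 0) + D (0, F t \<eta>)) (at t within {0..})"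
    by (simp only: has_field_derivative_def)
  \<comment> \<open>The derivative of density times Jacobian determinant along a trajectory is
    computed in two ways. Here the chain and product rules produce the continuity expression times
    \<open>det (M t \<xi>)\<close>.\<close>
  from DERIV_mult[OF this det_M_deriv[OF t, of \<xi>]]
  have d1: "((\<lambda>s. transported s (\<Phi> s \<xi>) * det (M s \<xi>)) has_real_derivative
      (D (1, 0) + D (0, F t \<eta>)) * det (M t \<xi>) + (\<delta> * det (M t \<xi>)) * transported t \<eta>) (at t within {0..})"
    by (simp only: \<delta>_def \<xi>)
  \<comment> \<open>Directly from the definition: along the trajectory the initial value is
    constantly \<open>\<xi>\<close> and the determinants cancel, leaving an affine function of
    time.\<close>
  have d2: "((\<lambda>s. transported s (\<Phi> s \<xi>) * det (M s \<xi>)) has_real_derivative exp (- (\<xi> \<bullet> \<xi>))) (at t within {0..})"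
  proof (rule has_field_derivative_transform_within[where d=1 and f="\<lambda>s. (1 + s) * exp (- (\<xi> \<bullet> \<xi>))"])
    show "(1 + s) * exp (- (\<xi> \<bullet> \<xi>)) = transported s (\<Phi> s \<xi>) * det (M s \<xi>)" if "s \<in> {0..}" for s
      using det_M_pos[of s \<xi>] that by (simp add: transported_def)
    show "((\<lambda>s. (1 + s) * exp (- (\<xi> \<bullet> \<xi>))) has_real_derivative exp (- (\<xi> \<bullet> \<xi>))) (at t within {0..})"
      by (auto intro!: derivative_eq_intros)
  qed (use t in auto)
  have "(D (1, 0) + D (0, F t \<eta>)) * det (M t \<xi>) + (\<delta> * det (M t \<xi>)) * transported t \<eta> = exp (- (\<xi> \<bullet> \<xi>))"
    by (rule has_field_derivative_unique[OF d1 d2 nb])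
  then have "(D (1, 0) + (D (0, F t \<eta>) + transported t \<eta> * \<delta>)) * det (M t \<xi>) > 0"
    by (simp add: algebra_simps)
  then show ?thesis
    using det_M_pos[OF t, of \<xi>] by (simp add: 1 2 3 zero_less_mult_iff)
qed

text \<open>Domination by a Gaussian in \<open>\<eta>\<close>. Linear growth forces initial values
  to be large when \<open>\<eta>\<close> is large, which controls the exponential; a lower bound on
  the trace suffices for the other factor, since only the inverse of the determinant occurs.\<close>

lemma transported_integrable:
  assumes t: "t \<ge> 0"
    and growth: "\<And>\<xi>. norm (\<Phi> t \<xi>) \<le> K * (1 + norm \<xi>)"
    and k: "k integrable_on {0..t}" "\<And>s y. s \<in> {0..t} \<Longrightarrow> - trace (matrix (F' s y)) \<le> k s"
  shows "integrable lborel (transported t)"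
proof -
  \<comment> \<open>From \<open>(1 + x)\<^sup>2 \<le> 2 * (1 + x\<^sup>2)\<close>, growth gives
    \<open>a * (\<eta> \<bullet> \<eta>) \<le> 1 + \<xi> \<bullet> \<xi>\<close>. The leftover 1
    accounts for \<open>exp 1\<close> in \<open>C\<close>, and the maximum with 1 keeps the
    denominator away from 0.\<close>
  define a where "a = 1 / (2 * (max K 1)\<^sup>2)"
  have a: "a > 0" by (simp add: a_def)
  define C where "C = (1 + t) * exp 1 * exp (integral {0..t} k)"
  have "integrable lborel (\<lambda>\<eta>::real^'n. C * exp (- a * (\<eta> \<bullet> \<eta>)))"
    by (intro integrable_mult_right integrable_gaussian a)
  then show ?thesis
  proof (rule Bochner_Integration.integrable_bound)
    have "C1_on UNIV (transported t)" by (intro C1_state C1_transported t)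
    then show "transported t \<in> borel_measurable lborel"
      using C1_on_imp_continuous_on by (auto intro: borel_measurable_continuous_onI)
    show "AE \<eta> in lborel. norm (transported t \<eta>) \<le> norm (C * exp (- a * (\<eta> \<bullet> \<eta>)))"
    proof (rule AE_I2)
      fix \<eta> :: "real^'n"
      define \<xi> where "\<xi> = \<Psi> t \<eta>"
      have "norm \<eta> \<le> max K 1 * (1 + norm \<xi>)"
        using growth[of \<xi>] mult_right_mono[of K "max K 1" "1 + norm \<xi>"] t by (simp add: \<xi>_def)
      from power_mono[OF this norm_ge_zero, of 2] have "(norm \<eta>)\<^sup>2 \<le> (max K 1)\<^sup>2 * (1 + norm \<xi>)\<^sup>2"
        by (simp only: power_mult_distrib)
      also have "\<dots> \<le> (max K 1)\<^sup>2 * (2 * (1 + (norm \<xi>)\<^sup>2))"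
        using sum_squares_bound[of 1 "norm \<xi>"] by (intro mult_left_mono) (auto simp: power2_sum)
      finally have "a * (\<eta> \<bullet> \<eta>) \<le> 1 + \<xi> \<bullet> \<xi>"
        by (simp add: a_def power2_norm_eq_inner field_simps)
      then have 1: "exp (- (\<xi> \<bullet> \<xi>)) \<le> exp 1 * exp (- a * (\<eta> \<bullet> \<eta>))"
        by (simp flip: exp_add)
      have "- integral {0..t} (\<lambda>s. trace (matrix (F' s (\<Phi> s \<xi>)))) \<le> integral {0..t} k"
      proof -
        have "continuous_on {0..t} (\<lambda>s. trace (matrix (F' s (\<Phi> s \<xi>))))"
          by (intro linear_continuous_on_compose[OF _ linear_trace]
              bounded_linear.continuous_on[OF bounded_linear_matrix_blinfun] F'_along
              \<Phi>_time_cont continuous_intros) auto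
        then have "(\<lambda>s. - trace (matrix (F' s (\<Phi> s \<xi>)))) integrable_on {0..t}"
          by (intro integrable_continuous_real continuous_intros)
        from integral_le[OF this k(1)] k(2) show ?thesis by simp
      qed
      then have 2: "inverse (det (M t \<xi>)) \<le> exp (integral {0..t} k)"
        by (simp add: det_M[OF t] flip: exp_minus)
      have "transported t \<eta> \<le> (1 + t) * (exp 1 * exp (- a * (\<eta> \<bullet> \<eta>))) * exp (integral {0..t} k)"
        unfolding transported_def \<xi>_def[symmetric]
        using 1 2 t det_M_pos[OF t, of \<xi>] by (intro mult_mono mult_left_mono) auto
      also have "\<dots> = C * exp (- a * (\<eta> \<bullet> \<eta>))" by (simp add: C_def)
      finally have "transported t \<eta> \<le> C * exp (- a * (\<eta> \<bullet> \<eta>))" .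
      then show "norm (transported t \<eta>) \<le> norm (C * exp (- a * (\<eta> \<bullet> \<eta>)))"
        using transported_nonneg[OF t, of \<eta>] by simp
    qed
  qed
qed

lemma density_function_transported:
  assumes zero: "\<And>t. t \<ge> 0 \<Longrightarrow> F t 0 = 0"
    and growth: "\<And>t. t \<ge> 0 \<Longrightarrow> \<exists>K. \<forall>\<xi>. norm (\<Phi> t \<xi>) \<le> K * (1 + norm \<xi>)"
    and trace: "\<And>t. t \<ge> 0 \<Longrightarrow>
      \<exists>k. k integrable_on {0..t} \<and> (\<forall>s\<in>{0..t}. \<forall>y. - trace (matrix (F' s y)) \<le> k s)"
  shows "density_function F transported"
  unfolding density_function_def
proof (intro conjI allI impI)
  show "C1_on ({0..} \<times> - {0}) (\<lambda>(t, z). transported t z)"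
    using C1_on_subset[OF C1_transported, of "{0..} \<times> - {0}"] by (auto simp: case_prod_beta')
  show "set_integrable lborel (- ball 0 r) (transported t)" if t: "t \<ge> 0" for t r
  proof -
    obtain K where K: "\<And>\<xi>. norm (\<Phi> t \<xi>) \<le> K * (1 + norm \<xi>)" using growth[OF t] by blast
    obtain k where k: "k integrable_on {0..t}" "\<And>s y. s \<in> {0..t} \<Longrightarrow> - trace (matrix (F' s y)) \<le> k s"
      using trace[OF t] by blast
    show ?thesis
      unfolding set_integrable_def
      by (intro integrable_mult_indicator transported_integrable[OF t K k]) auto
  qed
qed (use zero transported_nonneg transported_continuity_equation in auto)

end

section \<open>Bounded perturbations of a linear system\<close>

lemma norm_matrix_vector_mult_le_opnorm: "norm (M *v v) \<le> opnorm M * norm v"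
  unfolding opnorm_def by (rule onorm) simp

text \<open>Converts the Lipschitz condition in (P2) into a bound on the state derivative of
  \<open>f\<close>, by testing the difference quotient on a short multiple of
  \<open>v\<close>.\<close>

lemma norm_derivative_le_lipschitz:
  fixes g :: "'a::real_normed_vector \<Rightarrow> 'b::real_normed_vector"
  assumes g: "(g has_derivative g') (at y)"
    and lip: "\<And>z. norm (g z - g y) \<le> L * norm (z - y)"
  shows "norm (g' v) \<le> L * norm v"
proof (cases "v = 0")
  case True
  then show ?thesis using linear_0[OF has_derivative_linear[OF g]] by simp
next
  case False
  interpret g': bounded_linear g' by (rule has_derivative_bounded_linear[OF g])
  have "norm (g' v) / norm v \<le> L"
  proof (rule field_le_epsilon)
    fix e :: real assume "e > 0"
    then obtain d where d: "d > 0"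
      "\<And>z. norm (z - y) < d \<Longrightarrow> norm (g z - g y - g' (z - y)) \<le> e * norm (z - y)"
      using g unfolding has_derivative_at_alt by blast
    define h where "h = (d / (2 * norm v)) *\<^sub>R v"
    have h: "norm h = d / 2" using False d by (simp add: h_def)
    have "norm (g' h) \<le> norm (g (y + h) - g y) + norm (g (y + h) - g y - g' h)"
      using norm_triangle_sub[of "g' h" "g (y + h) - g y"] by (simp add: norm_minus_commute)
    also have "\<dots> \<le> L * norm h + e * norm h"
      using lip[of "y + h"] d(2)[of "y + h"] h d(1) by (intro add_mono) auto
    finally have "norm (g' h) \<le> (L + e) * norm h" by (simp add: algebra_simps)
    moreover have "norm (g' h) = norm h / norm v * norm (g' v)"
      using False d by (simp add: h_def g'.scaleR)
    ultimately have "norm h * (norm (g' v) / norm v) \<le> norm h * (L + e)" by (simp add: mult.commute)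
    then show "norm (g' v) / norm v \<le> L + e" by (rule mult_left_le_imp_le) (simp add: h d(1))
  qed
  then show ?thesis using False by (simp add: field_simps)
qed

lemma norm_bounded_on_Icc:
  fixes h :: "real \<Rightarrow> 'a::real_normed_vector"
  assumes "continuous_on {a..b} h"
  obtains B where "B > 0" "\<And>t. t \<in> {a..b} \<Longrightarrow> norm (h t) \<le> B"
proof -
  have "bounded (h ` {a..b})"
    by (intro compact_imp_bounded compact_continuous_image assms compact_Icc)
  then show thesis using that unfolding bounded_pos by auto
qed

section \<open>The transition matrix of the linear system\<close>

locale linear_system =
  fixes A X :: "real \<Rightarrow> real^'n^'n"
  assumes A_cont: "continuous_on {0..} A" and X_fund: "fundamental_matrix A X"
begin

abbreviation "Y t \<equiv> matrix_inv (X t)"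

lemma X_deriv: "t \<ge> 0 \<Longrightarrow> (X has_vector_derivative A t ** X t) (at t within {0..})"
  using X_fund unfolding fundamental_matrix_def solves_ode_def by blast

lemma X_invertible: "t \<ge> 0 \<Longrightarrow> invertible (X t)"
  using X_fund unfolding fundamental_matrix_def by blast

lemma XY: "t \<ge> 0 \<Longrightarrow> X t ** Y t = mat 1" and YX: "t \<ge> 0 \<Longrightarrow> Y t ** X t = mat 1"
  by (simp_all add: X_invertible matrix_inv_right matrix_inv_left)

lemma X_cont: "continuous_on {0..} X"
  using X_deriv by (intro has_vector_derivative_imp_continuous_on) auto

lemma Y_cont: "continuous_on {0..} Y"
proof (rule C1_on_imp_continuous_on, rule C1_on_matrix_inv)
  show "C1_on {0..} X"
  proof (rule C1_onI[where h'="\<lambda>t v. v *\<^sub>R (A t ** X t)"])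
    show "(X has_derivative (\<lambda>v. v *\<^sub>R (A t ** X t))) (at t within {0..})" if "t \<in> {0..}" for t
      using X_deriv[of t] that by (simp add: has_vector_derivative_def)
    show "continuous_on {0..} (\<lambda>t. v *\<^sub>R (A t ** X t))" for v
      by (intro continuous_intros bounded_bilinear.continuous_on[OF bounded_bilinear_matrix_matrix_mult]
          A_cont X_cont)
  qed
  show "invertible (X t)" if "t \<in> {0..}" for t
    using X_invertible that by simp
qed

lemma transition_self: "t \<ge> 0 \<Longrightarrow> transition X t t = mat 1"
  by (simp add: transition_def XY)

lemma transition_mult:
  assumes "r \<ge> 0"
  shows "transition X t r ** transition X r s = transition X t s"
proof -
  have "transition X t r ** transition X r s = X t ** (Y r ** X r) ** Y s"
    by (simp only: transition_def matrix_mul_assoc)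
  then show ?thesis by (simp add: YX assms transition_def)
qed

lemma transition_apply: "r \<ge> 0 \<Longrightarrow> transition X t r *v (transition X r s *v v) = transition X t s *v v"
  by (simp add: matrix_vector_mul_assoc transition_mult)

lemma transition_cont1: "continuous_on {0..} (\<lambda>t. transition X t s)"
  and transition_cont2: "continuous_on {0..} (\<lambda>s. transition X t s)"
  unfolding transition_def
  by (intro bounded_bilinear.continuous_on[OF bounded_bilinear_matrix_matrix_mult] X_cont Y_cont
      continuous_on_const)+

end

text \<open>The kernel \<open>\<kappa> t s\<close> abstracts \<open>D(s) (\<mu>(t) / \<mu>(s))\<^sup>-\<^sup>\<alpha>\<close>. The linear system itself is the case
  \<open>f = 0\<close>.\<close>

locale perturbed_linear_system = linear_system A X for A X :: "real \<Rightarrow> real^'n^'n" +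
  fixes f :: "real \<Rightarrow> real^'n \<Rightarrow> real^'n"
    and f' :: "real \<Rightarrow> real^'n \<Rightarrow> (real^'n) \<Rightarrow>\<^sub>L (real^'n)"
    and f'' :: "real \<Rightarrow> real^'n \<Rightarrow> (real^'n) \<Rightarrow>\<^sub>L ((real^'n) \<Rightarrow>\<^sub>L (real^'n))"
    and \<kappa> :: "real \<Rightarrow> real \<Rightarrow> real" and \<beta> \<gamma> :: "real \<Rightarrow> real" and C p q :: real
  assumes f_cont: "continuous_on ({0..} \<times> UNIV) (\<lambda>(t, z). f t z)"
    and f_zero: "t \<ge> 0 \<Longrightarrow> f t 0 = 0"
    and f_deriv: "t \<ge> 0 \<Longrightarrow> (f t has_derivative blinfun_apply (f' t z)) (at z)"
    and f'_deriv: "t \<ge> 0 \<Longrightarrow> (f' t has_derivative blinfun_apply (f'' t z)) (at z)"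
    and f'_cont: "continuous_on ({0..} \<times> UNIV) (\<lambda>(t, z). f' t z)"
    and f''_cont: "continuous_on ({0..} \<times> UNIV) (\<lambda>(t, z). f'' t z)"
    and kernel: "0 \<le> s \<Longrightarrow> s \<le> t \<Longrightarrow> opnorm (transition X t s) \<le> \<kappa> t s"
    and kernel_0: "t \<ge> 0 \<Longrightarrow> \<kappa> t 0 \<le> C"
    and f_bound: "t \<ge> 0 \<Longrightarrow> norm (f t z) \<le> \<beta> t"
    and f_lipschitz: "t \<ge> 0 \<Longrightarrow> norm (f t z - f t w) \<le> \<gamma> t * norm (z - w)"
    and \<beta>_int: "t \<ge> 0 \<Longrightarrow> (\<lambda>s. \<kappa> t s * \<beta> s) integrable_on {0..t}"
    and \<beta>_le: "t \<ge> 0 \<Longrightarrow> integral {0..t} (\<lambda>s. \<kappa> t s * \<beta> s) \<le> p"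
    and \<gamma>_nonneg: "t \<ge> 0 \<Longrightarrow> \<gamma> t \<ge> 0"
    and \<gamma>_int: "t \<ge> 0 \<Longrightarrow> (\<lambda>s. \<kappa> t s * \<gamma> s) integrable_on {0..t}"
    and \<gamma>_le: "t \<ge> 0 \<Longrightarrow> integral {0..t} (\<lambda>s. \<kappa> t s * \<gamma> s) \<le> q"
    and q_less: "q < 1"
begin

definition F :: "real \<Rightarrow> real^'n \<Rightarrow> real^'n" where "F t z = A t *v z + f t z"
definition F' :: "real \<Rightarrow> real^'n \<Rightarrow> (real^'n) \<Rightarrow>\<^sub>L (real^'n)" where
  "F' t z = Blinfun ((*v) (A t)) + f' t z"
text \<open>Variation of constants with the factor \<open>X t\<close> taken out of the integral: the
  remaining integrand does not depend on \<open>t\<close>, so the product rule gives the derivative.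
  The form with the transition matrix is \<open>duhamel_eq\<close>.\<close>

definition duhamel :: "real^'n \<Rightarrow> (real \<Rightarrow> real^'n) \<Rightarrow> real \<Rightarrow> real^'n" where
  "duhamel \<xi> z t = X t *v (Y 0 *v \<xi> + integral {0..t} (\<lambda>s. Y s *v f s (z s)))"

lemma transition_bound: "0 \<le> s \<Longrightarrow> s \<le> t \<Longrightarrow> norm (transition X t s *v v) \<le> \<kappa> t s * norm v"
  using norm_matrix_vector_mult_le_opnorm[of "transition X t s" v] mult_right_mono[OF kernel[of s t], of "norm v"]
  by simp

lemma kernel_nonneg: "0 \<le> s \<Longrightarrow> s \<le> t \<Longrightarrow> \<kappa> t s \<ge> 0"
  using order_trans[OF norm_ge_zero transition_bound[of s t "axis undefined 1"]] by (simp add: norm_axis_1)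

lemma q_nonneg: "q \<ge> 0"
  using \<gamma>_le[of 0] by simp

lemma f_along: "continuous_on {0..} z \<Longrightarrow> continuous_on {0..} (\<lambda>s. Y s *v f s (z s))"
proof -
  assume z: "continuous_on {0..} z"
  have "continuous_on {0..} (\<lambda>s. (s, z s))" by (intro continuous_intros z)
  from continuous_on_compose2[OF f_cont this] have "continuous_on {0..} (\<lambda>s. f s (z s))" by auto
  then show ?thesis
    by (rule bounded_bilinear.continuous_on[OF bounded_bilinear_matrix_vector_mult Y_cont])
qed

lemma f_along_integrable:
  "continuous_on {0..} z \<Longrightarrow> (\<lambda>s. Y s *v f s (z s)) integrable_on {0..t}"
  by (intro integrable_continuous_real continuous_on_subset[OF f_along]) auto

lemma X_integral:
  assumes "continuous_on {0..} z"
  shows "X t *v integral {0..t} (\<lambda>s. Y s *v f s (z s)) = integral {0..t} (\<lambda>s. transition X t s *v f s (z s))"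
    and "(\<lambda>s. transition X t s *v f s (z s)) integrable_on {0..t}"
  using integral_linear[OF f_along_integrable[OF assms], of "(*v) (X t)" t]
    integrable_linear[OF f_along_integrable[OF assms], of "(*v) (X t)" t]
  by (simp_all add: o_def matrix_vector_mul_assoc transition_def)

lemma duhamel_eq:
  "continuous_on {0..} z \<Longrightarrow>
    duhamel \<xi> z t = transition X t 0 *v \<xi> + integral {0..t} (\<lambda>s. transition X t s *v f s (z s))"
  by (simp add: duhamel_def matrix_vector_right_distrib X_integral matrix_vector_mul_assoc transition_def)

lemma duhamel_deriv:
  assumes z: "continuous_on {0..} z" and t: "t \<ge> 0"
  shows "(duhamel \<xi> z has_vector_derivative A t *v duhamel \<xi> z t + f t (z t)) (at t within {0..})"
proof -
  define u where "u t = Y 0 *v \<xi> + integral {0..t} (\<lambda>s. Y s *v f s (z s))" for t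
  have "(u has_vector_derivative Y t *v f t (z t)) (at t within {0..})"
    unfolding u_def
    by (auto intro!: derivative_eq_intros has_vector_derivative_integral_atLeast f_along z t)
  from bounded_bilinear.has_vector_derivative[OF bounded_bilinear_matrix_vector_mult X_deriv[OF t] this]
  have "((\<lambda>t. X t *v u t) has_vector_derivative A t *v (X t *v u t) + f t (z t)) (at t within {0..})"
    by (simp add: matrix_vector_mul_assoc XY t add.commute)
  then show ?thesis by (simp add: duhamel_def[abs_def] u_def)
qed

lemma duhamel_cont: "continuous_on {0..} z \<Longrightarrow> continuous_on {0..} (duhamel \<xi> z)"
  using duhamel_deriv by (intro has_vector_derivative_imp_continuous_on) auto

lemma duhamel_contraction:
  assumes z: "continuous_on {0..} z" and w: "continuous_on {0..} w"
    and b: "\<And>s. s \<ge> 0 \<Longrightarrow> norm (z s - w s) \<le> b" and t: "t \<ge> 0"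
  shows "norm (duhamel \<xi> z t - duhamel \<xi> w t) \<le> q * b"
proof -
  let ?d = "\<lambda>s. transition X t s *v f s (z s) - transition X t s *v f s (w s)"
  have "b \<ge> 0" using b[of 0] norm_ge_zero order_trans by blast
  have "norm (integral {0..t} ?d) \<le> integral {0..t} (\<lambda>s. \<kappa> t s * \<gamma> s * b)"
  proof (rule integral_norm_bound_integral)
    show "?d integrable_on {0..t}" by (intro integrable_diff X_integral z w)
    show "(\<lambda>s. \<kappa> t s * \<gamma> s * b) integrable_on {0..t}"
      using \<gamma>_int[OF t] by (rule integrable_on_mult_left)
    fix s assume s: "s \<in> {0..t}"
    have "norm (?d s) \<le> \<kappa> t s * norm (f s (z s) - f s (w s))"
      using transition_bound[of s t "f s (z s) - f s (w s)"] s
      by (simp add: matrix_vector_mult_diff_distrib)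
    also have "\<dots> \<le> \<kappa> t s * (\<gamma> s * norm (z s - w s))"
      using f_lipschitz kernel_nonneg s by (intro mult_left_mono) auto
    also have "\<dots> \<le> \<kappa> t s * (\<gamma> s * b)"
      using kernel_nonneg \<gamma>_nonneg b s by (intro mult_left_mono) auto
    finally show "norm (?d s) \<le> \<kappa> t s * \<gamma> s * b" by (simp add: mult.assoc)
  qed
  also have "\<dots> \<le> q * b"
    using \<gamma>_le[OF t] \<open>b \<ge> 0\<close> by (simp add: mult_right_mono)
  finally show ?thesis
    by (simp add: duhamel_eq z w integral_diff X_integral)
qed

text \<open>As \<open>f\<close> vanishes at 0, the zero function is mapped to the linear solution,
  which \<open>kernel_0\<close> bounds. The contraction estimate then keeps all images of bounded
  functions bounded.\<close>

lemma duhamel_fixpoint: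
  obtains y where "continuous_on {0..} y" "\<And>t. t \<ge> 0 \<Longrightarrow> y t = duhamel \<xi> y t"
proof (rule bounded_continuous_fixpoint[of "duhamel \<xi>" q])
  fix z :: "real \<Rightarrow> real^'n" assume z: "continuous_on {0..} z" "bounded (z ` {0..})"
  obtain B where B: "\<And>s. s \<ge> 0 \<Longrightarrow> norm (z s) \<le> B"
    using z(2) by (auto simp: bounded_iff)
  have "norm (duhamel \<xi> z t) \<le> C * norm \<xi> + q * B" if t: "t \<ge> 0" for t
  proof -
    have "integral {0..t} (\<lambda>s. transition X t s *v f s 0) = integral {0..t} (\<lambda>s. 0)"
      by (rule integral_cong) (simp add: f_zero)
    then have "norm (duhamel \<xi> (\<lambda>_. 0) t) \<le> \<kappa> t 0 * norm \<xi>"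
      using transition_bound[of 0 t \<xi>] t by (simp add: duhamel_eq)
    also have "\<dots> \<le> C * norm \<xi>" using kernel_0[OF t] by (intro mult_right_mono) auto
    finally have "norm (duhamel \<xi> (\<lambda>_. 0) t) \<le> C * norm \<xi>" .
    moreover have "norm (duhamel \<xi> z t - duhamel \<xi> (\<lambda>_. 0) t) \<le> q * B"
      using B by (intro duhamel_contraction z t continuous_on_const) auto
    ultimately show ?thesis using norm_triangle_sub[of "duhamel \<xi> z t" "duhamel \<xi> (\<lambda>_. 0) t"] by simp
  qed
  then have "bounded (duhamel \<xi> z ` {0..})" by (auto simp: bounded_iff)
  then show "continuous_on {0..} (duhamel \<xi> z) \<and> bounded (duhamel \<xi> z ` {0..})"
    using duhamel_cont[OF z(1)] by blast
qed (use duhamel_contraction q_nonneg q_less that in auto)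

text \<open>One further application of \<open>duhamel\<close> leaves the fixed point unchanged at
  nonnegative times and lets \<open>duhamel_deriv\<close> apply verbatim.\<close>

definition \<Phi> :: "real \<Rightarrow> real^'n \<Rightarrow> real^'n" where
  "\<Phi> t \<xi> = duhamel \<xi> (SOME y. continuous_on {0..} y \<and> (\<forall>t\<ge>0. y t = duhamel \<xi> y t)) t"

lemma \<Phi>_solves: "solves_ode F (\<lambda>t. \<Phi> t \<xi>)"
  and \<Phi>_duhamel: "t \<ge> 0 \<Longrightarrow>
    \<Phi> t \<xi> = transition X t 0 *v \<xi> + integral {0..t} (\<lambda>s. transition X t s *v f s (\<Phi> s \<xi>))"
proof -
  define y where "y = (SOME y. continuous_on {0..} y \<and> (\<forall>t\<ge>0. y t = duhamel \<xi> y t))"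
  have "\<exists>y. continuous_on {0..} y \<and> (\<forall>t\<ge>0. y t = duhamel \<xi> y t)"
    using duhamel_fixpoint by metis
  from someI_ex[OF this] have y: "continuous_on {0..} y" "\<And>t. t \<ge> 0 \<Longrightarrow> y t = duhamel \<xi> y t"
    by (auto simp: y_def)
  have \<Phi>: "\<Phi> t \<xi> = duhamel \<xi> y t" for t by (simp add: \<Phi>_def y_def)
  show "solves_ode F (\<lambda>t. \<Phi> t \<xi>)"
    unfolding solves_ode_def \<Phi> F_def using duhamel_deriv[OF y(1), of _ \<xi>] y(2) by auto
  assume "t \<ge> 0"
  have "integral {0..t} (\<lambda>s. transition X t s *v f s (y s)) = integral {0..t} (\<lambda>s. transition X t s *v f s (\<Phi> s \<xi>))"
    by (rule integral_cong) (simp add: \<Phi> y(2)[symmetric])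
  then show "\<Phi> t \<xi> = transition X t 0 *v \<xi> + integral {0..t} (\<lambda>s. transition X t s *v f s (\<Phi> s \<xi>))"
    using duhamel_eq[OF y(1), of \<xi> t] by (simp add: \<Phi>)
qed

lemma \<Phi>_0: "\<Phi> 0 \<xi> = \<xi>"
  by (simp add: \<Phi>_duhamel transition_self)

text \<open>The distance to the linear solution is bounded independently of the initial value. Read
  in one direction this gives properness of the flow, in the other its linear growth.\<close>

lemma forcing_bound:
  assumes t: "t \<ge> 0"
  shows "norm (\<Phi> t \<xi> - transition X t 0 *v \<xi>) \<le> p"
proof -
  have "norm (integral {0..t} (\<lambda>s. transition X t s *v f s (\<Phi> s \<xi>))) \<le> integral {0..t} (\<lambda>s. \<kappa> t s * \<beta> s)"
  proof (rule integral_norm_bound_integral)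
    show "(\<lambda>s. transition X t s *v f s (\<Phi> s \<xi>)) integrable_on {0..t}"
      by (intro X_integral solves_ode_continuous_on[OF \<Phi>_solves])
    show "norm (transition X t s *v f s (\<Phi> s \<xi>)) \<le> \<kappa> t s * \<beta> s" if "s \<in> {0..t}" for s
      using transition_bound[of s t "f s (\<Phi> s \<xi>)"] f_bound[of s "\<Phi> s \<xi>"] kernel_nonneg[of s t] that
      by (meson atLeastAtMost_iff mult_left_mono order_trans)
  qed (rule \<beta>_int[OF t])
  then show ?thesis using \<beta>_le[OF t] \<Phi>_duhamel[OF t, of \<xi>] by simp
qed

lemma blinfun_A [simp]: "blinfun_apply (Blinfun ((*v) (A t))) = (*v) (A t)"
  by (rule bounded_linear_Blinfun_apply) simp

sublocale proper_C2_flow F F' \<Phi> f''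
proof
  show "continuous_on ({0..} \<times> UNIV) (\<lambda>(t, y). F t y)"
  proof -
    have "continuous_on ({0..} \<times> UNIV) (\<lambda>p :: real \<times> (real^'n). A (fst p) *v snd p)"
      by (intro bounded_bilinear.continuous_on[OF bounded_bilinear_matrix_vector_mult]
          continuous_on_compose2[OF A_cont] continuous_intros) auto
    then show ?thesis
      using f_cont unfolding F_def by (auto simp: case_prod_beta' intro!: continuous_on_add)
  qed
  show "(F t has_derivative blinfun_apply (F' t y)) (at y)" if t: "t \<ge> 0" for t y
    unfolding F_def[abs_def] F'_def
    by (rule has_derivative_eq_rhs[OF has_derivative_add[OF _ f_deriv[OF t]]])
      (auto simp: blinfun.add_left fun_eq_iff intro!: bounded_linear_imp_has_derivative)
  show "continuous_on ({0..} \<times> UNIV) (\<lambda>(t, y). F' t y)"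
  proof -
    have "continuous_on ({0..} \<times> UNIV) (\<lambda>p :: real \<times> (real^'n). A (fst p))"
      by (intro continuous_on_compose2[OF A_cont] continuous_intros) auto
    from bounded_linear.continuous_on[OF bounded_linear_Blinfun_matrix this]
    show ?thesis
      using f'_cont unfolding F'_def by (auto simp: case_prod_beta' intro!: continuous_on_add)
  qed
  show "solves_ode F (\<lambda>t. \<Phi> t \<xi>)" for \<xi> by (rule \<Phi>_solves)
  show "\<Phi> 0 \<xi> = \<xi>" for \<xi> by (rule \<Phi>_0)
  show "(F' t has_derivative blinfun_apply (f'' t y)) (at y)" if "t \<ge> 0" for t y
    unfolding F'_def[abs_def] using f'_deriv[OF that] by (auto intro!: derivative_eq_intros)
  show "continuous_on ({0..} \<times> UNIV) (\<lambda>(t, y). f'' t y)" by (rule f''_cont)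
  show "\<exists>R. \<forall>t\<in>{0..T}. \<forall>\<xi>. norm (\<Phi> t \<xi>) \<le> r \<longrightarrow> norm \<xi> \<le> R" if "T \<ge> 0" for T r
  proof -
    \<comment> \<open>The constant is that of matrix-vector multiplication as a bilinear map,
      because \<open>norm\<close> on matrices is not the induced operator norm.\<close>
    obtain K where K: "K > 0" "\<And>M v. norm (M *v v) \<le> norm (M :: real^'n^'n) * norm v * K"
      using bounded_bilinear.pos_bounded[OF bounded_bilinear_matrix_vector_mult] by blast
    have "continuous_on {0..T} (\<lambda>t. transition X 0 t)"
      by (rule continuous_on_subset[OF transition_cont2]) auto
    then obtain B where B: "B > 0" "\<And>t. t \<in> {0..T} \<Longrightarrow> norm (transition X 0 t) \<le> B"
      using norm_bounded_on_Icc by blast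
    \<comment> \<open>The linear solution at time \<open>t\<close> has norm at most
      \<open>r + p\<close>, and the bounded matrix \<open>transition X 0 t\<close> carries it back
      to \<open>\<xi>\<close>.\<close>
    have "norm \<xi> \<le> B * (r + p) * K" if t: "t \<in> {0..T}" and r: "norm (\<Phi> t \<xi>) \<le> r" for t \<xi>
    proof -
      have "norm (transition X t 0 *v \<xi>) \<le> r + p"
        using forcing_bound[of t \<xi>] t r norm_triangle_sub[of "transition X t 0 *v \<xi>" "\<Phi> t \<xi>"]
        by (simp add: norm_minus_commute)
      then have "norm (transition X 0 t) * norm (transition X t 0 *v \<xi>) * K \<le> B * (r + p) * K"
        using B K t by (intro mult_right_mono mult_mono) auto
      moreover have "transition X 0 t *v (transition X t 0 *v \<xi>) = \<xi>"
        using t by (simp add: transition_apply transition_self)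
      ultimately show ?thesis using K(2)[of "transition X 0 t" "transition X t 0 *v \<xi>"] by simp
    qed
    then show ?thesis by blast
  qed
qed

lemma density_function_F: "density_function F transported"
proof (rule density_function_transported)
  fix t :: real assume t: "t \<ge> 0"
  show "F t 0 = 0" by (simp add: F_def f_zero t)
  show "\<exists>K. \<forall>\<xi>. norm (\<Phi> t \<xi>) \<le> K * (1 + norm \<xi>)"
  proof (intro exI allI)
    fix \<xi>
    have "norm (\<Phi> t \<xi>) \<le> \<kappa> t 0 * norm \<xi> + p"
      using transition_bound[of 0 t \<xi>] forcing_bound[OF t, of \<xi>] t
        norm_triangle_sub[of "\<Phi> t \<xi>" "transition X t 0 *v \<xi>"] by simp
    also have "\<dots> \<le> (\<kappa> t 0 + p) * (1 + norm \<xi>)"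
      using kernel_nonneg[of 0 t] t norm_ge_zero[of \<xi>] order_trans[OF norm_ge_zero forcing_bound[OF t, of \<xi>]]
      by (simp add: algebra_simps)
    finally show "norm (\<Phi> t \<xi>) \<le> (\<kappa> t 0 + p) * (1 + norm \<xi>)" .
  qed
  show "\<exists>k. k integrable_on {0..t} \<and> (\<forall>s\<in>{0..t}. \<forall>y. - trace (matrix (F' s y)) \<le> k s)"
  proof -
    obtain K where K: "K > 0" "\<And>M v. norm (M *v v) \<le> norm (M :: real^'n^'n) * norm v * K"
      using bounded_bilinear.pos_bounded[OF bounded_bilinear_matrix_vector_mult] by blast
    have "continuous_on {0..t} (\<lambda>s. transition X s t)"
      by (rule continuous_on_subset[OF transition_cont1]) auto
    then obtain B where B: "B > 0" "\<And>s. s \<in> {0..t} \<Longrightarrow> norm (transition X s t) \<le> B"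
      using norm_bounded_on_Icc by blast
    \<comment> \<open>Going from time \<open>t\<close> to \<open>s\<close> and back is the identity,
      so the bound \<open>B\<close> on one transition matrix forces a lower bound on the kernel that
      dominates the other. Hence \<open>\<gamma> s\<close> lies below a multiple of the integrable
      function \<open>\<kappa> t s * \<gamma> s\<close>.\<close>
    have \<kappa>: "1 \<le> B * K * \<kappa> t s" if s: "s \<in> {0..t}" for s
    proof -
      define v :: "real^'n" where "v = axis undefined 1"
      have v: "norm v = 1" by (simp add: v_def norm_axis_1)
      have "norm v \<le> norm (transition X s t) * norm (transition X t s *v v) * K"
        using K(2)[of "transition X s t" "transition X t s *v v"] s
        by (simp add: transition_apply transition_self t)
      also have "\<dots> \<le> B * \<kappa> t s * K"
        using B(2)[OF s] transition_bound[of s t v] K(1) B(1) s v by (intro mult_right_mono mult_mono) auto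
      finally show ?thesis by (simp add: v mult_ac)
    qed
    \<comment> \<open>Each diagonal entry of the Jacobian of \<open>f\<close> is at least
      \<open>- \<gamma> s\<close>, and there are \<open>CARD('n)\<close> of them;
      \<open>B * K\<close> is the constant from the lower bound on the kernel.\<close>
    define k where "k s = - trace (A s) + real CARD('n) * (B * K) * (\<kappa> t s * \<gamma> s)" for s
    have "continuous_on {0..t} (\<lambda>s. - trace (A s))"
      by (intro continuous_intros linear_continuous_on_compose[OF continuous_on_subset[OF A_cont] linear_trace]) auto
    then have "k integrable_on {0..t}"
      unfolding k_def by (rule integrable_add[OF integrable_continuous_real integrable_on_mult_right[OF \<gamma>_int[OF t]]])
    moreover have "- trace (matrix (F' s y)) \<le> k s" if s: "s \<in> {0..t}" for s y
    proof -
      have le: "norm (f' s y (axis i 1)) \<le> \<gamma> s" for i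
        using norm_derivative_le_lipschitz[OF f_deriv, of s y "\<gamma> s" "axis i 1"] f_lipschitz[of s] s
        by (simp add: norm_axis_1)
      have "\<gamma> s \<le> B * K * (\<kappa> t s * \<gamma> s)"
        using mult_right_mono[OF \<kappa>[OF s] \<gamma>_nonneg[of s]] s by (simp add: mult.assoc)
      then have "real CARD('n) * \<gamma> s \<le> real CARD('n) * (B * K * (\<kappa> t s * \<gamma> s))"
        by (intro mult_left_mono) auto
      moreover have "trace (matrix (F' s y)) = trace (A s) + (\<Sum>i\<in>UNIV. f' s y (axis i 1) $ i)"
        by (simp add: trace_def matrix_def F'_def blinfun.add_left sum.distrib matrix_vector_mul_component inner_axis)
      moreover have "(\<Sum>i\<in>UNIV. - (f' s y (axis i 1) $ i)) \<le> (\<Sum>i\<in>(UNIV::'n set). \<gamma> s)"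
      proof (rule sum_mono)
        show "- (f' s y (axis i 1) $ i) \<le> \<gamma> s" for i
          using component_le_norm_cart[of "f' s y (axis i 1)" i] le[of i] by linarith
      qed
      ultimately show ?thesis unfolding k_def sum_negf sum_constant mult.assoc by linarith
    qed
    ultimately show ?thesis by blast
  qed
qed

end

section \<open>The diffeomorphism between the two flows and the pair of densities\<close>

theorem theorem3:
  fixes A :: "real \<Rightarrow> real^'n^'n"
    and f :: "real \<Rightarrow> real^'n \<Rightarrow> real^'n"
    and X :: "real \<Rightarrow> real^'n^'n"
    and \<alpha> c d :: real
    and D \<mu> \<beta> \<gamma> :: "real \<Rightarrow> real"
    and y :: "real \<Rightarrow> real \<Rightarrow> real^'n \<Rightarrow> real^'n"
    and G :: "real \<Rightarrow> real^'n \<Rightarrow> real^'n"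
  defines "y \<equiv> ode_solution (\<lambda>t z. A t *v z + f t z)"
    and "G \<equiv> \<lambda>t \<eta>. \<eta> - integral {0..t} (\<lambda>s. transition X t s *v f s (y s t \<eta>))"
  assumes A_cont: "continuous_on {0..} A"
    and A_bdd: "bounded (A ` {0..})"
    and f_cont: "continuous_on ({0..} \<times> UNIV) (\<lambda>(t, z). f t z)"
    and f_zero: "\<And>t. t \<ge> 0 \<Longrightarrow> f t 0 = 0"
    and X_fund: "fundamental_matrix A X"
    and P1_alpha: "\<alpha> > 0"
    and P1_D: "\<And>s. s \<ge> 0 \<Longrightarrow> D s > 0"
    and P1_mu_C1: "C1_on {0..} \<mu>"
    and P1_mu_mono: "mono_on {0..} \<mu>"
    and P1_mu_ge: "\<And>t. t \<ge> 0 \<Longrightarrow> \<mu> t \<ge> 1"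
    and P1_mu_zero: "\<mu> 0 = 1"
    and P1_mu_lim: "filterlim \<mu> at_top at_top"
    and P1: "\<And>s t. 0 \<le> s \<Longrightarrow> s \<le> t \<Longrightarrow>
               opnorm (transition X t s) \<le> D s * (\<mu> t / \<mu> s) powr (- \<alpha>)"
    and P2_pos: "\<And>t. t \<ge> 0 \<Longrightarrow> \<beta> t > 0 \<and> \<gamma> t > 0"
    and P2_bound: "\<And>t z. t \<ge> 0 \<Longrightarrow> norm (f t z) \<le> \<beta> t"
    and P2_lipschitz: "\<And>t z w. t \<ge> 0 \<Longrightarrow> norm (f t z - f t w) \<le> \<gamma> t * norm (z - w)"
    and P3_defined: "\<And>t. t \<ge> 0 \<Longrightarrow>
               (\<lambda>s. D s * (\<mu> t / \<mu> s) powr (- \<alpha>) * \<beta> s) integrable_on {0..t}"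
    and P3: "bdd_above ((\<lambda>t. integral {0..t} (\<lambda>s. D s * (\<mu> t / \<mu> s) powr (- \<alpha>) * \<beta> s)) ` {0..})"
    and P4_defined: "\<And>t. t \<ge> 0 \<Longrightarrow>
               (\<lambda>s. D s * (\<mu> t / \<mu> s) powr (- \<alpha>) * \<gamma> s) integrable_on {0..t}"
    and P4_bdd: "bdd_above ((\<lambda>t. integral {0..t} (\<lambda>s. D s * (\<mu> t / \<mu> s) powr (- \<alpha>) * \<gamma> s)) ` {0..})"
    and P4: "(SUP t\<in>{0..}. integral {0..t} (\<lambda>s. D s * (\<mu> t / \<mu> s) powr (- \<alpha>) * \<gamma> s)) < 1"
    and c_pos: "c > 0"
    and d_ge: "d \<ge> 1"
    and X_bdd: "\<And>s t. 0 \<le> s \<Longrightarrow> s \<le> t \<Longrightarrow> \<mu> t \<le> d * \<mu> s \<Longrightarrow> opnorm (transition X t s) \<le> c"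
    and f_C2: "C2_in_state f"
  shows "(\<forall>t\<ge>0. orientation_preserving_C2_diffeo (G t)) \<and>
         (\<exists>\<rho> \<rho>bar.
            density_function (\<lambda>t x. A t *v x) \<rho> \<and>
            density_function (\<lambda>t z. A t *v z + f t z) \<rho>bar \<and>
            continuous_on ({0..} \<times> (- {0})) (\<lambda>(t, \<eta>). \<rho>bar t \<eta>) \<and>
            (\<forall>t\<ge>0. \<forall>\<eta>. \<eta> \<noteq> 0 \<longrightarrow> \<rho>bar t \<eta> = \<rho> t (G t \<eta>) * det (jacobian (G t) (at \<eta>))))"
proof -
  obtain f' f'' where C2:
    "\<And>t z. t \<ge> 0 \<Longrightarrow> (f t has_derivative blinfun_apply (f' t z)) (at z)"
    "\<And>t z. t \<ge> 0 \<Longrightarrow> (f' t has_derivative blinfun_apply (f'' t z)) (at z)"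
    "continuous_on ({0..} \<times> UNIV) (\<lambda>(t, z). f' t z)"
    "continuous_on ({0..} \<times> UNIV) (\<lambda>(t, z). f'' t z)"
    using f_C2 unfolding C2_in_state_def by blast
  define \<kappa> where "\<kappa> t s = D s * (\<mu> t / \<mu> s) powr (- \<alpha>)" for t s
  define q where "q = (SUP t\<in>{0..}. integral {0..t} (\<lambda>s. D s * (\<mu> t / \<mu> s) powr (- \<alpha>) * \<gamma> s))"
  define p where "p = (SUP t\<in>{0..}. integral {0..t} (\<lambda>s. D s * (\<mu> t / \<mu> s) powr (- \<alpha>) * \<beta> s))"
  have kernel: "opnorm (transition X t s) \<le> \<kappa> t s" if "0 \<le> s" "s \<le> t" for s t
    using P1[OF that] by (simp add: \<kappa>_def)
  have kernel_0: "\<kappa> t 0 \<le> D 0" if "t \<ge> 0" for t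
  proof -
    have "\<mu> t powr (- \<alpha>) \<le> 1"
      using ge_one_powr_ge_zero[OF P1_mu_ge[OF that], of \<alpha>] P1_alpha
      by (simp add: powr_minus inverse_le_1_iff)
    then show ?thesis
      using mult_left_mono[of "\<mu> t powr (- \<alpha>)" 1 "D 0"] P1_D[of 0] by (simp add: \<kappa>_def P1_mu_zero)
  qed
  interpret linear_system A X by unfold_locales (rule A_cont X_fund)+
  interpret lin: perturbed_linear_system A X "\<lambda>_ _. 0" "\<lambda>_ _. 0" "\<lambda>_ _. 0" \<kappa> "\<lambda>_. 0" "\<lambda>_. 0" "D 0" 0 0
    by unfold_locales (auto simp: zero_blinfun.rep_eq intro!: kernel kernel_0)
  interpret nl: perturbed_linear_system A X f f' f'' \<kappa> \<beta> \<gamma> "D 0" p q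
  proof unfold_locales
    show "integral {0..t} (\<lambda>s. \<kappa> t s * \<beta> s) \<le> p" if "t \<ge> 0" for t
      unfolding p_def \<kappa>_def using that by (intro cSUP_upper P3) auto
    show "integral {0..t} (\<lambda>s. \<kappa> t s * \<gamma> s) \<le> q" if "t \<ge> 0" for t
      unfolding q_def \<kappa>_def using that by (intro cSUP_upper P4_bdd) auto
    show "(\<lambda>s. \<kappa> t s * \<beta> s) integrable_on {0..t}" "(\<lambda>s. \<kappa> t s * \<gamma> s) integrable_on {0..t}"
      if "t \<ge> 0" for t
      unfolding \<kappa>_def using P3_defined[OF that] P4_defined[OF that] .
    show "q < 1" unfolding q_def by (rule P4)
    show "\<gamma> t \<ge> 0" if "t \<ge> 0" for t using P2_pos[OF that] by simp
  qed (rule f_cont C2 kernel kernel_0 f_zero P2_bound P2_lipschitz; assumption)+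
  let ?T = "transition X"
  have F_lin: "lin.F = (\<lambda>t x. A t *v x)" and F_nl: "nl.F = (\<lambda>t z. A t *v z + f t z)"
    by (simp_all add: fun_eq_iff lin.F_def nl.F_def)
  have \<Phi>_lin: "lin.\<Phi> t = (*v) (?T t 0)" if "t \<ge> 0" for t
    using lin.\<Phi>_duhamel[OF that] by (simp add: fun_eq_iff)
  have M_lin: "lin.M t \<xi> = ?T t 0" if "t \<ge> 0" for t \<xi>
  proof -
    have "(*v) (lin.M t \<xi>) = (*v) (?T t 0)"
      using lin.\<Phi>_deriv_M[OF that, of \<xi>] unfolding \<Phi>_lin[OF that]
      by (rule has_derivative_unique) (simp add: bounded_linear_imp_has_derivative)
    then show ?thesis by (metis matrix_of_matrix_vector_mul)
  qed
  \<comment> \<open>The solution through \<open>\<eta>\<close> at time \<open>t\<close> is the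
    trajectory of \<open>nl.\<Psi> t \<eta>\<close>. Its Duhamel formula at time \<open>t\<close>
    expresses \<open>\<eta>\<close> as the linear evolution plus exactly the integral that
    \<open>G\<close> subtracts.\<close>
  have G: "G t \<eta> = ?T t 0 *v nl.\<Psi> t \<eta>" if "t \<ge> 0" for t \<eta>
  proof -
    have "integral {0..t} (\<lambda>s. ?T t s *v f s (y s t \<eta>)) = integral {0..t} (\<lambda>s. ?T t s *v f s (nl.\<Phi> s (nl.\<Psi> t \<eta>)))"
      using that by (intro integral_cong) (simp add: y_def F_nl[symmetric] nl.ode_solution_eq)
    then show ?thesis
      using nl.\<Phi>_duhamel[OF that, of "nl.\<Psi> t \<eta>"] by (simp add: G_def diff_eq_eq that)
  qed
  have G_deriv: "(G t has_derivative (*v) (?T t 0 ** matrix_inv (nl.M t (nl.\<Psi> t \<eta>)))) (at \<eta>)"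
    if t: "t \<ge> 0" for t \<eta>
  proof -
    have "((\<lambda>\<eta>. ?T t 0 *v nl.\<Psi> t \<eta>) has_derivative (\<lambda>v. ?T t 0 *v (matrix_inv (nl.M t (nl.\<Psi> t \<eta>)) *v v))) (at \<eta>)"
      by (rule bounded_linear.has_derivative[OF matrix_vector_mul_bounded_linear nl.\<Psi>_deriv[OF t]])
    then show ?thesis by (simp add: G[OF t, abs_def] matrix_vector_mul_assoc fun_eq_iff)
  qed
  have det_inv: "det (matrix_inv (nl.M t \<xi>)) = inverse (det (nl.M t \<xi>))" if "t \<ge> 0" for t \<xi>
    using matrix_inv_right[OF nl.M_invertible[OF that, of \<xi>]] nl.det_M_pos[OF that, of \<xi>]
    by (metis det_I det_mul inverse_unique)
  \<comment> \<open>Liouville's formula for the linear instance, whose Jacobian is the transition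
    matrix itself.\<close>
  have det_T: "det (?T t 0) > 0" if "t \<ge> 0" for t
    using lin.det_M_pos[OF that, of 0] by (simp add: M_lin that)
  have "orientation_preserving_C2_diffeo (G t)" if t: "t \<ge> 0" for t
  proof -
    \<comment> \<open>The inverse of \<open>G t\<close>: return to time 0 along the linear system,
      then go forward to time \<open>t\<close> along the perturbed one.\<close>
    define H where "H x = nl.\<Phi> t (?T 0 t *v x)" for x
    have GH: "G t (H x) = x" and HG: "H (G t x) = x" for x
      by (simp_all add: H_def G t transition_apply transition_self)
    have bij: "bij (G t)"
      by (rule bij_betw_byWitness[where f'=H]) (auto simp: GH HG)
    have inv: "inv (G t) = H"
      by (rule inv_equality) (simp_all add: GH HG)
    have "C2 (G t)"
      by (rule C2I[OF G_deriv[OF t]], rule C1_on_linear_compose[OF bounded_bilinear.bounded_linear_right[OF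
            bounded_bilinear_matrix_matrix_mult] nl.C1_matrix_inv_M_\<Psi>[OF t]])
    moreover have "C2 H"
    proof (rule C2I)
      show "(H has_derivative (*v) (nl.M t (?T 0 t *v x) ** ?T 0 t)) (at x)" for x
      proof -
        have "((\<lambda>x. ?T 0 t *v x) has_derivative (\<lambda>v. ?T 0 t *v v)) (at x)"
          by (simp add: bounded_linear_imp_has_derivative)
        from has_derivative_compose[OF this nl.\<Phi>_deriv_M[OF t]]
        show ?thesis by (simp add: H_def[abs_def] matrix_vector_mul_assoc)
      qed
      have "C1_on UNIV (nl.M t)"
        using nl.C1_M by (intro nl.C1_state t) (simp add: case_prod_beta')
      from C1_on_compose[OF C1_on_bounded_linear[OF matrix_vector_mul_bounded_linear] this]
      have "C1_on UNIV (\<lambda>x. nl.M t (?T 0 t *v x))" by simp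
      then show "C1_on UNIV (\<lambda>x. nl.M t (?T 0 t *v x) ** ?T 0 t)"
        by (rule C1_on_linear_compose[OF bounded_bilinear.bounded_linear_left[OF bounded_bilinear_matrix_matrix_mult]])
    qed
    moreover have "det (jacobian (G t) (at \<eta>)) > 0" for \<eta>
      unfolding jacobian_eq[OF G_deriv[OF t]]
      using det_T[OF t] nl.det_M_pos[OF t] by (simp add: det_mul det_inv t)
    ultimately show ?thesis using bij by (simp add: orientation_preserving_C2_diffeo_def inv)
  qed
  moreover have "density_function (\<lambda>t x. A t *v x) lin.transported"
    using lin.density_function_F by (simp add: F_lin)
  moreover have nl: "density_function (\<lambda>t z. A t *v z + f t z) nl.transported"
    using nl.density_function_F by (simp add: F_nl)
  moreover have "continuous_on ({0..} \<times> (- {0})) (\<lambda>(t, \<eta>). nl.transported t \<eta>)"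
    using nl unfolding density_function_def by (blast intro: C1_on_imp_continuous_on)
  moreover have "nl.transported t \<eta> = lin.transported t (G t \<eta>) * det (jacobian (G t) (at \<eta>))"
    if t: "t \<ge> 0" for t \<eta>
  proof -
    \<comment> \<open>Both points come from the same initial value, so the Gaussian factors agree.
      In the remaining factor, the determinant of the transition matrix in the Jacobian of
      \<open>G t\<close> cancels its inverse in \<open>lin.transported\<close>.\<close>
    have "lin.\<Psi> t (G t \<eta>) = nl.\<Psi> t \<eta>"
      using lin.\<Psi>_\<Phi>[OF t, of "nl.\<Psi> t \<eta>"] by (simp add: G[OF t] \<Phi>_lin[OF t])
    then show ?thesis
      using det_T[OF t]
      by (simp add: nl.transported_def lin.transported_def M_lin t jacobian_eq[OF G_deriv[OF t]] det_mul det_inv)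
  qed
  ultimately show ?thesis by blast
qed

end
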